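(* Let $\mathcal{G}$ and $\mathcal{H}$ be two hypergraphs on the vertex set $V$ and let $n=\|\mathcal{G}\|+\|\mathcal{H}\|$. The problem of deciding whether $\mathcal{G}$ and $\mathcal{H}$ are not dual (the problem co-DUAL) belongs to $\mathrm{GC}(\log^2 n,\mathrm{TC}^0)$.
   Context: A hypergraph $\mathcal{G}=\langle V,E\rangle$ has a finite vertex set $V$ and an edge set $E\subseteq 2^V$; we identify $\mathcal{G}$ with its edge set. Standing assumptions: the two hypergraphs share the vertex set $V$, every vertex belongs to some edge, and (unless explicitly said otherwise) hypergraphs are non-empty and do not contain the empty edge. A transversal of $\mathcal{G}$ is a set $T\subseteq V$ meeting every edge; it is minimal if no proper subset is a transversal; $tr(\mathcal{G})$ denotes the hypergraph of minimal transversals of $\mathcal{G}$. $\mathcal{G}$ and $\mathcal{H}$ are dual if $\mathcal{H}=tr(\mathcal{G})$. $\|\mathcal{G}\|$ is the number of bits needed to represent $\mathcal{G}$, given by the adjacency lists of its edges. For a function $f$ and a complexity class $\mathcal{C}$, $\mathrm{GC}(f(n),\mathcal{C})$ is the class of problems that, after a nondeterministic guess of $O(f(n))$ bits, can be decided (checked) within $\mathcal{C}$ (i.e., the input is a yes-instance iff some guess of $O(f(n))$ bits makes the $\mathcal{C}$-check accept). $\mathrm{TC}^0$ denotes logtime-uniform $\mathrm{TC}^0$, equivalently the problems definable in first-order logic with counting quantifiers FO(COUNT). *)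

theory Defs
  imports Complex_Main
begin

section \<open>Hypergraphs, transversals, duality\<close>

text \<open>A hypergraph on the vertex set \<open>V\<close> is identified with its edge set.\<close>

definition hypergraph :: "'v set \<Rightarrow> 'v set set \<Rightarrow> bool" where
  "hypergraph V G \<longleftrightarrow>
     finite V \<and> G \<subseteq> Pow V \<and> (\<forall>v\<in>V. \<exists>E\<in>G. v \<in> E) \<and> G \<noteq> {} \<and> {} \<notin> G"

definition transversal :: "'v set \<Rightarrow> 'v set set \<Rightarrow> 'v set \<Rightarrow> bool" where
  "transversal V G T \<longleftrightarrow> T \<subseteq> V \<and> (\<forall>E\<in>G. T \<inter> E \<noteq> {})"

definition tr :: "'v set \<Rightarrow> 'v set set \<Rightarrow> 'v set set" where
  "tr V G = {T. transversal V G T \<and> (\<forall>T'. T' \<subset> T \<longrightarrow> \<not> transversal V G T')}"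

definition dual :: "'v set \<Rightarrow> 'v set set \<Rightarrow> 'v set set \<Rightarrow> bool" where
  "dual V G H \<longleftrightarrow> H = tr V G"


section \<open>Binary representation by adjacency lists\<close>

text \<open>
  Vertices are named by natural numbers, written in binary without leading zeros, least
  significant bit first (so 0 is the empty numeral). A representation is first a word over four
  symbols: the two digits, an end-of-vertex mark and an end-of-edge mark; each symbol takes two
  bits. Edges being non-empty, an empty adjacency list (a second consecutive end-of-edge mark)
  terminates a hypergraph. Edges, and vertices within an edge, may be listed in any order but
  without repetition.
\<close>

fun binary :: "nat \<Rightarrow> bool list" where
  "binary n = (if n = 0 then [] else odd n # binary (n div 2))"

declare binary.simps [simp del]

definition digit :: "bool \<Rightarrow> bool list" where
  "digit b = [False, b]"

definition end_vertex :: "bool list" where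
  "end_vertex = [True, False]"

definition end_edge :: "bool list" where
  "end_edge = [True, True]"

definition enc_vertex :: "nat \<Rightarrow> bool list" where
  "enc_vertex v = concat (map digit (binary v)) @ end_vertex"

definition enc_edge :: "nat list \<Rightarrow> bool list" where
  "enc_edge e = concat (map enc_vertex e) @ end_edge"

definition enc_hypergraph :: "nat list list \<Rightarrow> bool list" where
  "enc_hypergraph es = concat (map enc_edge es) @ enc_edge []"

definition adj_lists :: "nat set set \<Rightarrow> nat list list \<Rightarrow> bool" where
  "adj_lists G es \<longleftrightarrow>
     set (map set es) = G \<and> distinct (map set es) \<and> (\<forall>e\<in>set es. distinct e)"

definition represents :: "bool list \<Rightarrow> nat set set \<Rightarrow> nat set set \<Rightarrow> bool" where
  "represents w G H \<longleftrightarrow>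
     (\<exists>gs hs. adj_lists G gs \<and> adj_lists H hs \<and> w = enc_hypergraph gs @ enc_hypergraph hs)"

text \<open>
  The size of a hypergraph is the number of bits of its representation. It does not depend on
  the order of the lists, and a word representing a pair has the sum of the two sizes as its
  length.
\<close>

definition hsize :: "nat set set \<Rightarrow> nat" where
  "hsize G = (\<Sum>E\<in>G. (\<Sum>v\<in>E. 2 * length (binary v) + 2) + 2) + 2"

lemma length_enc_edge:
  assumes "distinct e"
  shows "length (enc_edge e) = (\<Sum>v\<in>set e. 2 * length (binary v) + 2) + 2"
proof -
  have d: "length (concat (map digit bs)) = 2 * length bs" for bs
    by (induction bs) (auto simp: digit_def)
  have "length (enc_vertex v) = 2 * length (binary v) + 2" for v
    by (simp add: enc_vertex_def end_vertex_def d)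
  then have "length (enc_edge e) = sum_list (map (\<lambda>v. 2 * length (binary v) + 2) e) + 2"
    by (simp add: enc_edge_def end_edge_def length_concat o_def)
  with assms show ?thesis
    by (simp add: sum_list_distinct_conv_sum_set)
qed

lemma length_enc_hypergraph:
  assumes "adj_lists G es"
  shows "length (enc_hypergraph es) = hsize G"
proof -
  let ?f = "\<lambda>E. (\<Sum>v\<in>E. 2 * length (binary v) + 2) + 2"
  have G: "G = set (map set es)" and ds: "distinct (map set es)"
    and de: "\<And>e. e \<in> set es \<Longrightarrow> distinct e"
    using assms by (auto simp: adj_lists_def)
  have "map (\<lambda>e. length (enc_edge e)) es = map ?f (map set es)"
    by (simp add: length_enc_edge de)
  moreover have "length (enc_hypergraph es) = sum_list (map (\<lambda>e. length (enc_edge e)) es) + 2"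
    unfolding enc_hypergraph_def length_append length_concat map_map o_def
    by (simp add: enc_edge_def[of "[]"] end_edge_def)
  ultimately have "length (enc_hypergraph es) = sum_list (map ?f (map set es)) + 2"
    by (simp only:)
  also have "sum_list (map ?f (map set es)) = sum ?f (set (map set es))"
    by (rule sum_list_distinct_conv_sum_set[OF ds])
  finally show ?thesis
    unfolding hsize_def G .
qed

lemma length_represents:
  "represents w G H \<Longrightarrow> length w = hsize G + hsize H"
  by (auto simp: represents_def length_enc_hypergraph)

text \<open>Words that represent no pair of hypergraphs are no-instances.\<close>

definition coDUAL :: "bool list set" where
  "coDUAL = {w. \<exists>V G H. hypergraph V G \<and> hypergraph V H \<and> represents w G H \<and> \<not> dual V G H}"


section \<open>First-order logic with counting on words\<close>

text \<open>
  Formulas are interpreted over the positions \<open>{0..<length w}\<close> of a word \<open>w\<close>, which also serve as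
  the numbers. In \<open>ExCount y x \<phi>\<close> the variable \<open>x\<close> is bound and \<open>y\<close> is free: it says that the
  number of \<open>x\<close> satisfying \<open>\<phi>\<close> is exactly \<open>y\<close>. Addition and multiplication are first-order
  definable from the order and \<open>BIT\<close>, so having them as atoms does not add expressive power.
\<close>

datatype 'a form =
    Letter 'a nat
  | Eq nat nat
  | Leq nat nat
  | PLUS nat nat nat
  | TIMES nat nat nat
  | BIT nat nat
  | Neg "'a form"
  | Conj "'a form" "'a form"
  | Ex nat "'a form"
  | ExCount nat nat "'a form"

fun sat :: "'a list \<Rightarrow> (nat \<Rightarrow> nat) \<Rightarrow> 'a form \<Rightarrow> bool" where
  "sat w e (Letter a x) \<longleftrightarrow> e x < length w \<and> w ! e x = a"
| "sat w e (Eq x y) \<longleftrightarrow> e x = e y"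
| "sat w e (Leq x y) \<longleftrightarrow> e x \<le> e y"
| "sat w e (PLUS x y z) \<longleftrightarrow> e x + e y = e z"
| "sat w e (TIMES x y z) \<longleftrightarrow> e x * e y = e z"
| "sat w e (BIT x i) \<longleftrightarrow> bit (e x) (e i)"
| "sat w e (Neg \<phi>) \<longleftrightarrow> \<not> sat w e \<phi>"
| "sat w e (Conj \<phi> \<psi>) \<longleftrightarrow> sat w e \<phi> \<and> sat w e \<psi>"
| "sat w e (Ex x \<phi>) \<longleftrightarrow> (\<exists>a<length w. sat w (e(x := a)) \<phi>)"
| "sat w e (ExCount y x \<phi>) \<longleftrightarrow> card {a. a < length w \<and> sat w (e(x := a)) \<phi>} = e y"

fun fv :: "'a form \<Rightarrow> nat set" where
  "fv (Letter a x) = {x}"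
| "fv (Eq x y) = {x, y}"
| "fv (Leq x y) = {x, y}"
| "fv (PLUS x y z) = {x, y, z}"
| "fv (TIMES x y z) = {x, y, z}"
| "fv (BIT x i) = {x, i}"
| "fv (Neg \<phi>) = fv \<phi>"
| "fv (Conj \<phi> \<psi>) = fv \<phi> \<union> fv \<psi>"
| "fv (Ex x \<phi>) = fv \<phi> - {x}"
| "fv (ExCount y x \<phi>) = insert y (fv \<phi> - {x})"

text \<open>
  Logtime-uniform \<open>TC\<^sup>0\<close>, as the class FO(COUNT). The defining formulas are closed, so the
  choice of the assignment is immaterial.
\<close>

definition TC0 :: "'a::finite list set set" where
  "TC0 = {L. \<exists>\<phi>. fv \<phi> = {} \<and> L = {w. sat w (\<lambda>_. 0) \<phi>}}"


section \<open>Guess and check\<close>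

text \<open>
  The pair of an input \<open>x\<close> and a guess \<open>y\<close> is the word \<open>x#y\<close>, with \<open>None\<close> as the separator. The
  bound on the guess is \<open>c \<cdot> f(n)\<close> for a constant \<open>c\<close>, not an arbitrary function in \<open>O(f(n))\<close>:
  the latter could carry non-computable information in its values.
\<close>

definition pair_word :: "bool list \<Rightarrow> bool list \<Rightarrow> bool option list" where
  "pair_word x y = map Some x @ None # map Some y"

definition GC :: "(nat \<Rightarrow> real) \<Rightarrow> bool option list set set \<Rightarrow> bool list set set" where
  "GC f \<C> = {L. \<exists>R\<in>\<C>. \<exists>c::real. \<forall>x.
     x \<in> L \<longleftrightarrow> (\<exists>y. real (length y) \<le> c * f (length x) \<and> pair_word x y \<in> R)}"

end

theory Submission
  imports Defs
begin

text \<open>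
  If some edge of \<open>H\<close> is not a minimal transversal of \<open>G\<close>, a first-order formula sees it. Otherwise
  non-duality is witnessed by a minimal transversal \<open>T\<close> of \<open>G\<close> that contains no edge of \<open>H\<close>. For a
  set \<open>X\<close> of excluded vertices, call a vertex outside \<open>X\<close> frequent if it lies in at least half of
  the edges of \<open>H\<close> that miss \<open>X\<close>. Starting from \<open>X = {}\<close>, as long as the frequent vertices do not form
  \<open>T\<close>, one can add to \<open>X\<close> a set disjoint from \<open>T\<close>, either \<open>{v}\<close> or \<open>g - {v}\<close> with \<open>v \<in> g \<in> G\<close>, so that
  the number of edges of \<open>H\<close> missing \<open>X\<close> is halved; once there is none, all vertices outside \<open>X\<close> are
  frequent and they contain \<open>T\<close>. So after \<open>O(log n)\<close> steps the set of frequent vertices is a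
  transversal of \<open>G\<close> without an edge of \<open>H\<close>. A step is described by one position of the input word: an
  occurrence of \<open>v\<close> in the edge \<open>g\<close> of \<open>G\<close> stands for \<open>g - {v}\<close>, an occurrence in an edge of \<open>H\<close> for
  \<open>{v}\<close>. Being frequent is definable by counting, and a guess can only be accepted by exhibiting a
  genuine witness, so that it needs no further check.
\<close>

section \<open>Definable predicates\<close>

text \<open>
  \<open>P\<close> speaks about an object \<open>d\<close>, coded by the word \<open>f d\<close>, and about positions \<open>e 0, \<dots>, e (k - 1)\<close>
  addressed by de Bruijn indices, so that the quantifier rules below need no freshness conditions.
  Index \<open>i\<close> is the variable \<open>k - i\<close>; the variable \<open>0\<close> is never used.
\<close>

definition defines_pred ::
    "('d \<Rightarrow> 'a list) \<Rightarrow> nat \<Rightarrow> 'a form \<Rightarrow> ('d \<Rightarrow> (nat \<Rightarrow> nat) \<Rightarrow> bool) \<Rightarrow> bool" where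
  "defines_pred f k \<phi> P \<longleftrightarrow> fv \<phi> \<subseteq> {1..k} \<and>
     (\<forall>d e. (\<forall>i\<in>{1..k}. e i < length (f d)) \<longrightarrow>
       (sat (f d) e \<phi> \<longleftrightarrow> P d (\<lambda>i. e (k - i))))"

definition definable ::
    "('d \<Rightarrow> 'a list) \<Rightarrow> nat \<Rightarrow> ('d \<Rightarrow> (nat \<Rightarrow> nat) \<Rightarrow> bool) \<Rightarrow> bool" where
  "definable f k P \<longleftrightarrow> (\<exists>\<phi>. defines_pred f k \<phi> P)"

lemma definableI:
  assumes "fv \<phi> \<subseteq> {1..k}"
    and "\<And>d e. \<forall>i\<in>{1..k}. e i < length (f d) \<Longrightarrow> sat (f d) e \<phi> \<longleftrightarrow> P d (\<lambda>i. e (k - i))"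
  shows "definable f k P"
  using assms unfolding definable_def defines_pred_def by blast

lemma definableE:
  assumes "definable f k P"
  obtains \<phi> where "defines_pred f k \<phi> P"
  using assms unfolding definable_def by (rule exE)

lemma defines_predD:
  assumes "defines_pred f k \<phi> P" "\<forall>i\<in>{1..k}. e i < length (f d)"
  shows "sat (f d) e \<phi> \<longleftrightarrow> P d (\<lambda>i. e (k - i))"
  using assms unfolding defines_pred_def by blast

lemma fv_if_defines_pred: "defines_pred f k \<phi> P \<Longrightarrow> fv \<phi> \<subseteq> {1..k}"
  unfolding defines_pred_def by blast

text \<open>Predicates have to agree only on assignments whose values are positions of the word.
  This is what allows arithmetic to be replaced by formulas whose quantifiers range over
  positions.\<close>

lemma definable_cong:
  assumes "definable f k P"
    and "\<And>d e. (\<And>i. i < k \<Longrightarrow> e i < length (f d)) \<Longrightarrow> P d e \<longleftrightarrow> Q d e"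
  shows "definable f k Q"
proof -
  obtain \<phi> where \<phi>: "defines_pred f k \<phi> P"
    using assms(1) by (rule definableE)
  show ?thesis
  proof (rule definableI[OF fv_if_defines_pred[OF \<phi>]])
    fix d e assume b: "\<forall>i\<in>{1..k}. e i < length (f d)"
    then have "P d (\<lambda>i. e (k - i)) \<longleftrightarrow> Q d (\<lambda>i. e (k - i))"
      by (intro assms(2)) auto
    then show "sat (f d) e \<phi> \<longleftrightarrow> Q d (\<lambda>i. e (k - i))"
      using defines_predD[OF \<phi> b] by blast
  qed
qed

lemma definable_letter:
  "i < k \<Longrightarrow> definable f k (\<lambda>d e. e i < length (f d) \<and> f d ! e i = a)"
  by (rule definableI[where \<phi> = "Letter a (k - i)"]) auto

lemma definable_eq: "i < k \<Longrightarrow> j < k \<Longrightarrow> definable f k (\<lambda>d e. e i = e j)"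
  by (rule definableI[where \<phi> = "Eq (k - i) (k - j)"]) auto

lemma definable_le: "i < k \<Longrightarrow> j < k \<Longrightarrow> definable f k (\<lambda>d e. e i \<le> e j)"
  by (rule definableI[where \<phi> = "Leq (k - i) (k - j)"]) auto

lemma definable_plus:
  "i < k \<Longrightarrow> j < k \<Longrightarrow> l < k \<Longrightarrow> definable f k (\<lambda>d e. e i + e j = e l)"
  by (rule definableI[where \<phi> = "PLUS (k - i) (k - j) (k - l)"]) auto

lemma definable_times:
  "i < k \<Longrightarrow> j < k \<Longrightarrow> l < k \<Longrightarrow> definable f k (\<lambda>d e. e i * e j = e l)"
  by (rule definableI[where \<phi> = "TIMES (k - i) (k - j) (k - l)"]) auto

lemma definable_bit: "i < k \<Longrightarrow> j < k \<Longrightarrow> definable f k (\<lambda>d e. bit (e i) (e j))"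
  by (rule definableI[where \<phi> = "BIT (k - i) (k - j)"]) auto

lemma definable_not:
  assumes "definable f k P" shows "definable f k (\<lambda>d e. \<not> P d e)"
proof -
  obtain \<phi> where \<phi>: "defines_pred f k \<phi> P"
    using assms by (rule definableE)
  show ?thesis
    by (rule definableI[where \<phi> = "Neg \<phi>"])
      (simp_all add: fv_if_defines_pred[OF \<phi>, simplified] defines_predD[OF \<phi>])
qed

lemma definable_conj:
  assumes "definable f k P" "definable f k Q"
  shows "definable f k (\<lambda>d e. P d e \<and> Q d e)"
proof -
  obtain \<phi> where \<phi>: "defines_pred f k \<phi> P"
    using assms(1) by (rule definableE)
  obtain \<psi> where \<psi>: "defines_pred f k \<psi> Q"
    using assms(2) by (rule definableE)
  show ?thesis
  proof (rule definableI[where \<phi> = "Conj \<phi> \<psi>"])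
    show "fv (Conj \<phi> \<psi>) \<subseteq> {1..k}"
      using fv_if_defines_pred[OF \<phi>] fv_if_defines_pred[OF \<psi>] by simp
  next
    fix d e assume b: "\<forall>i\<in>{1..k}. e i < length (f d)"
    show "sat (f d) e (Conj \<phi> \<psi>) \<longleftrightarrow> P d (\<lambda>i. e (k - i)) \<and> Q d (\<lambda>i. e (k - i))"
      unfolding sat.simps defines_predD[OF \<phi> b] defines_predD[OF \<psi> b] ..
  qed
qed

lemma definable_disj:
  assumes "definable f k P" "definable f k Q"
  shows "definable f k (\<lambda>d e. P d e \<or> Q d e)"
  using definable_not[OF definable_conj[OF definable_not[OF assms(1)] definable_not[OF assms(2)]]]
  unfolding de_Morgan_conj not_not .

lemma definable_imp:
  assumes "definable f k P" "definable f k Q"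
  shows "definable f k (\<lambda>d e. P d e \<longrightarrow> Q d e)"
  unfolding imp_conv_disj by (intro definable_disj definable_not assms)

lemma definable_iff:
  assumes "definable f k P" "definable f k Q"
  shows "definable f k (\<lambda>d e. P d e \<longleftrightarrow> Q d e)"
  unfolding iff_conv_conj_imp by (intro definable_conj definable_imp assms)

text \<open>Common core of \<open>Ex\<close> and \<open>ExCount\<close>. Binding the variable
  \<open>Suc k\<close> makes it index 0 and raises all other indices by one, since at level
  \<open>Suc k\<close> index \<open>i\<close> is the variable \<open>Suc k - i\<close>.\<close>

lemma definable_binder:
  assumes "definable f (Suc k) (\<lambda>d e. R d (\<lambda>i. e (Suc i)) (e 0))"
  shows "\<exists>\<phi>. fv \<phi> - {Suc k} \<subseteq> {1..k} \<and>
    (\<forall>d e a. (\<forall>i\<in>{1..k}. e i < length (f d)) \<longrightarrow> a < length (f d) \<longrightarrow>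
      (sat (f d) (e(Suc k := a)) \<phi> \<longleftrightarrow> R d (\<lambda>i. e (k - i)) a))"
proof -
  obtain \<phi> where \<phi>: "defines_pred f (Suc k) \<phi> (\<lambda>d e. R d (\<lambda>i. e (Suc i)) (e 0))"
    using assms by (rule definableE)
  have "sat (f d) (e(Suc k := a)) \<phi> \<longleftrightarrow> R d (\<lambda>i. e (k - i)) a"
    if "\<forall>i\<in>{1..k}. e i < length (f d)" and "a < length (f d)" for d e a
  proof -
    have "\<forall>i\<in>{1..Suc k}. (e(Suc k := a)) i < length (f d)"
      using that by (auto simp: le_Suc_eq)
    from defines_predD[OF \<phi> this] show ?thesis
      by (simp add: le_imp_less_Suc less_imp_neq fun_upd_def)
  qed
  moreover have "fv \<phi> - {Suc k} \<subseteq> {1..k}"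
    using fv_if_defines_pred[OF \<phi>] by (auto simp: le_Suc_eq subset_iff)
  ultimately show ?thesis by blast
qed

lemma definable_ex:
  assumes "definable f (Suc k) (\<lambda>d e. R d (\<lambda>i. e (Suc i)) (e 0))"
  shows "definable f k (\<lambda>d e. \<exists>a<length (f d). R d e a)"
proof -
  obtain \<phi> where 1: "fv \<phi> - {Suc k} \<subseteq> {1..k}"
    and 2: "\<forall>d e a. (\<forall>i\<in>{1..k}. e i < length (f d)) \<longrightarrow> a < length (f d) \<longrightarrow>
      (sat (f d) (e(Suc k := a)) \<phi> \<longleftrightarrow> R d (\<lambda>i. e (k - i)) a)"
    using definable_binder[where R = R, OF assms] by blast
  show ?thesis
  proof (rule definableI[where \<phi> = "Ex (Suc k) \<phi>"])
    fix d e assume "\<forall>i\<in>{1..k}. e i < length (f d)"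
    with 2 show "sat (f d) e (Ex (Suc k) \<phi>) \<longleftrightarrow> (\<exists>a<length (f d). R d (\<lambda>i. e (k - i)) a)"
      unfolding sat.simps by blast
  qed (use 1 in simp)
qed

lemma definable_count:
  assumes "definable f (Suc k) (\<lambda>d e. R d (\<lambda>i. e (Suc i)) (e 0))" "j < k"
  shows "definable f k (\<lambda>d e. card {a. a < length (f d) \<and> R d e a} = e j)"
proof -
  obtain \<phi> where 1: "fv \<phi> - {Suc k} \<subseteq> {1..k}"
    and 2: "\<forall>d e a. (\<forall>i\<in>{1..k}. e i < length (f d)) \<longrightarrow> a < length (f d) \<longrightarrow>
      (sat (f d) (e(Suc k := a)) \<phi> \<longleftrightarrow> R d (\<lambda>i. e (k - i)) a)"
    using definable_binder[where R = R, OF assms(1)] by blast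
  show ?thesis
  proof (rule definableI[where \<phi> = "ExCount (k - j) (Suc k) \<phi>"])
    fix d e assume "\<forall>i\<in>{1..k}. e i < length (f d)"
    then have "{a. a < length (f d) \<and> sat (f d) (e(Suc k := a)) \<phi>} =
        {a. a < length (f d) \<and> R d (\<lambda>i. e (k - i)) a}"
      using 2 by blast
    then show "sat (f d) e (ExCount (k - j) (Suc k) \<phi>) \<longleftrightarrow>
        card {a. a < length (f d) \<and> R d (\<lambda>i. e (k - i)) a} = e (k - j)"
      by simp
  qed (use 1 \<open>j < k\<close> in auto)
qed

lemma definable_all:
  assumes "definable f (Suc k) (\<lambda>d e. R d (\<lambda>i. e (Suc i)) (e 0))"
  shows "definable f k (\<lambda>d e. \<forall>a<length (f d). R d e a)"
  using definable_not[OF definable_ex[where R = "\<lambda>d e a. \<not> R d e a", OF definable_not[OF assms]]]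
  by simp

section \<open>Arithmetic and bounded quantifiers over positions\<close>

lemma definable_less: "i < k \<Longrightarrow> j < k \<Longrightarrow> definable f k (\<lambda>d e. e i < e j)"
  using definable_not[OF definable_le[of j k i]] by (simp add: not_le)

lemma definable_Suc:
  assumes "i < k" "j < k" shows "definable f k (\<lambda>d e. Suc (e i) = e j)"
proof (rule definable_cong)
  show "definable f k (\<lambda>d e. e i < e j \<and> (\<forall>a<length (f d). \<not> (e i < a \<and> a < e j)))"
    by (intro definable_conj definable_all definable_not definable_less) (use assms in auto)
next
  fix d e assume b: "\<And>i. i < k \<Longrightarrow> e i < length (f d)"
  show "(e i < e j \<and> (\<forall>a<length (f d). \<not> (e i < a \<and> a < e j))) \<longleftrightarrow> Suc (e i) = e j"
    using b[OF assms(2)] by (metis Suc_lessI lessI not_less_eq order_less_trans)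
qed

lemma definable_zero: "i < k \<Longrightarrow> definable f k (\<lambda>d e. e i = 0)"
  using definable_plus[of i k i i] by simp

text \<open>The bound \<open>e j\<close> is itself a position, so all numbers below it are in the
  range of the quantifier.\<close>

lemma definable_ex_less:
  assumes "definable f (Suc k) (\<lambda>d e. R d (\<lambda>i. e (Suc i)) (e 0))" and j: "j < k"
  shows "definable f k (\<lambda>d e. \<exists>a<e j. R d e a)"
proof (rule definable_cong)
  show "definable f k (\<lambda>d e. \<exists>a<length (f d). a < e j \<and> R d e a)"
    by (intro definable_ex definable_conj definable_less assms) (use j in auto)
qed (use j less_trans in blast)

lemma definable_all_less:
  assumes "definable f (Suc k) (\<lambda>d e. R d (\<lambda>i. e (Suc i)) (e 0))" and "j < k"
  shows "definable f k (\<lambda>d e. \<forall>a<e j. R d e a)"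
  using definable_not[OF definable_ex_less[where R = "\<lambda>d e a. \<not> R d e a",
      OF definable_not[OF assms(1)] assms(2)]] by simp

lemmas definable_intros =
  definable_all definable_ex definable_ex_less definable_all_less
  definable_conj definable_disj definable_imp definable_iff definable_not
  definable_eq definable_le definable_less definable_plus definable_times definable_bit
  definable_Suc definable_zero definable_letter

lemma definable_Suc_plus:
  assumes "i < k" "j < k" "l < k" shows "definable f k (\<lambda>d e. Suc (e i + e j) = e l)"
proof (rule definable_cong)
  show "definable f k (\<lambda>d e. \<exists>a<e l. e i + e j = a \<and> Suc a = e l)"
    by (intro definable_intros) (use assms in auto)
qed auto

text \<open>The formula \<psi> has its intended meaning only on words of the form
  \<open>f d\<close>; the conjunct \<phi> rules out all other words.\<close>

lemma TC0_if_definable: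
  assumes W: "definable (\<lambda>w. w) 0 (\<lambda>w e. w \<in> range f)" and P: "definable f 0 (\<lambda>d e. P d)"
  shows "{f d | d. P d} \<in> TC0"
proof -
  obtain \<phi> where \<phi>: "defines_pred (\<lambda>w. w) 0 \<phi> (\<lambda>w e. w \<in> range f)"
    using W by (rule definableE)
  obtain \<psi> where \<psi>: "defines_pred f 0 \<psi> (\<lambda>d e. P d)"
    using P by (rule definableE)
  from \<phi> \<psi> have 1: "fv \<phi> = {}" "\<And>w e. sat w e \<phi> \<longleftrightarrow> w \<in> range f"
    and 2: "fv \<psi> = {}" "\<And>d e. sat (f d) e \<psi> \<longleftrightarrow> P d"
    unfolding defines_pred_def by simp_all
  have "{f d | d. P d} = {w. sat w (\<lambda>_. 0) (Conj \<phi> \<psi>)}"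
    using 1 2 by auto
  moreover have "fv (Conj \<phi> \<psi>) = {}" using 1 2 by simp
  ultimately show ?thesis unfolding TC0_def by blast
qed

section \<open>Input words\<close>

text \<open>\<open>EV\<close> and \<open>EE\<close> are the end-of-vertex and end-of-edge marks. The
  four symbols use up all four pairs of bits.\<close>

datatype sym = Dig bool | EV | EE

fun sym_code :: "sym \<Rightarrow> bool list" where
  "sym_code (Dig b) = digit b"
| "sym_code EV = end_vertex"
| "sym_code EE = end_edge"

definition code :: "sym list \<Rightarrow> bool list" where
  "code s = concat (map sym_code s)"

abbreviation input_word :: "sym list \<times> bool list \<Rightarrow> bool option list" where
  "input_word d \<equiv> pair_word (code (fst d)) (snd d)"

lemma length_sym_code: "length (sym_code \<sigma>) = 2"
  by (cases \<sigma>) (auto simp: digit_def end_vertex_def end_edge_def)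

lemma sym_code_eq_iff: "\<sigma> = \<tau> \<longleftrightarrow> sym_code \<sigma> ! 0 = sym_code \<tau> ! 0 \<and> sym_code \<sigma> ! 1 = sym_code \<tau> ! 1"
  by (cases \<sigma>; cases \<tau>) (auto simp: digit_def end_vertex_def end_edge_def)

lemma code_simps [simp]:
  "code [] = []" "code (\<sigma> # s) = sym_code \<sigma> @ code s" "code (s @ t) = code s @ code t"
  by (simp_all add: code_def)

lemma length_code [simp]: "length (code s) = 2 * length s"
  by (induction s) (simp_all add: length_sym_code)

lemma nth_code:
  "i < length s \<Longrightarrow> j < 2 \<Longrightarrow> code s ! (2 * i + j) = sym_code (s ! i) ! j"
proof (induction s arbitrary: i)
  case (Cons \<sigma> s)
  then show ?case
    by (cases i) (simp_all add: nth_append length_sym_code)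
qed simp

text \<open>Every pair of bits is the code of a symbol, so the parity of the length is the only
  obstruction to decoding.\<close>

lemma ex_code: "even (length x) \<Longrightarrow> \<exists>s. code s = x"
proof (induction x rule: induct_list012)
  case 1
  show ?case by (rule exI[of _ "[]"]) simp
next
  case (3 a b x)
  then obtain s where "code s = x" by auto
  moreover have "sym_code (if a then if b then EE else EV else Dig b) = [a, b]"
    by (simp add: digit_def end_vertex_def end_edge_def)
  ultimately show ?case
    by (metis append_Cons append_Nil code_simps(2))
qed simp

lemma length_pair_word [simp]: "length (pair_word x y) = length x + 1 + length y"
  by (simp add: pair_word_def)

lemma nth_pair_word:
  "p < length x \<Longrightarrow> pair_word x y ! p = Some (x ! p)"
  "pair_word x y ! length x = None"
  "p < length y \<Longrightarrow> pair_word x y ! (length x + 1 + p) = Some (y ! p)"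
  by (simp_all add: pair_word_def nth_append)

lemma pair_word_eq_None_iff:
  assumes "p < length (pair_word x y)"
  shows "pair_word x y ! p = None \<longleftrightarrow> p = length x"
proof -
  consider "p < length x" | "p = length x" | q where "q < length y" "p = length x + 1 + q"
  proof -
    have "p < length x \<or> p = length x \<or> p = length x + 1 + (p - length x - 1) \<and> p - length x - 1 < length y"
      using assms by auto
    then show thesis using that by blast
  qed
  then show ?thesis
    by cases (use nth_pair_word(1)[of p x y] nth_pair_word(2)[of x y] nth_pair_word(3)[of _ y x] in auto)
qed

text \<open>Since every bit word of even length decodes, only the number and the parity of the
  separators matter. Repeating \<open>m < length w\<close> next to the letter test gives it exactly
  the form of a \<open>Letter\<close> atom.\<close>

lemma range_input_word_iff:
  "w \<in> range input_word \<longleftrightarrow> (\<exists>m<length w. (m < length w \<and> w ! m = None) \<and>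
     (\<forall>p<length w. (p < length w \<and> w ! p = None) \<longrightarrow> p = m) \<and> (\<exists>q<length w. q + q = m))"
    (is "_ \<longleftrightarrow> ?R")
proof
  assume "w \<in> range input_word"
  then obtain s y where w: "w = pair_word (code s) y" by auto
  have l: "length s < length w" "2 * length s < length w" by (simp_all add: w)
  have n: "w ! p = None \<longleftrightarrow> p = 2 * length s" if "p < length w" for p
    using that pair_word_eq_None_iff[of p "code s" y] by (simp add: w)
  show ?R
  proof (intro exI conjI allI impI)
    show "length s + length s = 2 * length s" by simp
  qed (use l n in auto)
next
  assume ?R
  then obtain m q where m: "m < length w" "w ! m = None" "m = q + q"
    and o: "\<And>p. p < length w \<Longrightarrow> w ! p = None \<Longrightarrow> p = m" by auto
  define x where "x = map the (take m w)"
  define y where "y = map the (drop (Suc m) w)"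
  have "w = take m w @ w ! m # drop (Suc m) w"
    using m(1) by (rule id_take_nth_drop)
  moreover have "map Some x = take m w"
    unfolding x_def
  proof (rule nth_equalityI)
    fix i assume "i < length (map Some (map the (take m w)))"
    then have "i < m" "i < length w" using m(1) by simp_all
    then have "w ! i \<noteq> None" using o by blast
    then show "map Some (map the (take m w)) ! i = take m w ! i"
      using \<open>i < m\<close> \<open>i < length w\<close> by simp
  qed simp
  moreover have "map Some y = drop (Suc m) w"
    unfolding y_def
  proof (rule nth_equalityI)
    fix i assume "i < length (map Some (map the (drop (Suc m) w)))"
    then have i: "Suc m + i < length w" by simp
    then have "w ! (Suc m + i) \<noteq> None" using o by fastforce
    then show "map Some (map the (drop (Suc m) w)) ! i = drop (Suc m) w ! i"
      using i by simp
  qed simp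
  ultimately have "w = pair_word x y"
    using m(2) by (simp add: pair_word_def)
  moreover obtain s where "code s = x"
    using ex_code[of x] m by (auto simp: x_def)
  ultimately show "w \<in> range input_word"
    by (intro image_eqI[of _ _ "(s, y)"]) auto
qed

lemma definable_range_input_word: "definable (\<lambda>w. w) 0 (\<lambda>w e. w \<in> range input_word)"
  unfolding range_input_word_iff by (intro definable_intros) auto

lemma definable_separator:
  assumes "i < k"
  shows "definable input_word k (\<lambda>d e. e i = 2 * length (fst d))"
proof (rule definable_cong)
  show "definable input_word k (\<lambda>d e. e i < length (input_word d) \<and> input_word d ! e i = None)"
    by (rule definable_letter[OF assms])
next
  fix d :: "sym list \<times> bool list" and e :: "nat \<Rightarrow> nat"
  assume "\<And>i. i < k \<Longrightarrow> e i < length (input_word d)"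
  with assms have "e i < length (input_word d)" by blast
  then show "(e i < length (input_word d) \<and> input_word d ! e i = None) \<longleftrightarrow> e i = 2 * length (fst d)"
    using pair_word_eq_None_iff[of "e i" "code (fst d)" "snd d"] by auto
qed

text \<open>Symbol \<open>i\<close> occupies the bits \<open>2 * i\<close> and
  \<open>2 * i + 1\<close>, so an index is legal iff its double lies before the separator.\<close>

lemma definable_index:
  assumes "i < k"
  shows "definable input_word k (\<lambda>d e. e i < length (fst d))"
proof (rule definable_cong)
  show "definable input_word k (\<lambda>d e. \<exists>m<length (input_word d). m = 2 * length (fst d) \<and>
      (\<exists>p<m. e i + e i = p))"
    by (intro definable_intros definable_separator) (use assms in auto)
qed auto

definition sym_at :: "sym list \<Rightarrow> sym \<Rightarrow> nat \<Rightarrow> bool" where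
  "sym_at s \<sigma> q \<longleftrightarrow> q < length s \<and> s ! q = \<sigma>"

lemma definable_sym_at:
  assumes "i < k"
  shows "definable input_word k (\<lambda>d e. sym_at (fst d) \<sigma> (e i))"
proof (rule definable_cong)
  show "definable input_word k (\<lambda>d e. e i < length (fst d) \<and>
      (\<exists>p<length (input_word d). e i + e i = p \<and> (\<exists>q<length (input_word d). Suc p = q \<and>
        (p < length (input_word d) \<and> input_word d ! p = Some (sym_code \<sigma> ! 0)) \<and>
        (q < length (input_word d) \<and> input_word d ! q = Some (sym_code \<sigma> ! 1)))))"
    by (intro definable_intros definable_index) (use assms in auto)
next
  fix d :: "sym list \<times> bool list" and e :: "nat \<Rightarrow> nat"
  show "(e i < length (fst d) \<and>
      (\<exists>p<length (input_word d). e i + e i = p \<and> (\<exists>q<length (input_word d). Suc p = q \<and>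
        (p < length (input_word d) \<and> input_word d ! p = Some (sym_code \<sigma> ! 0)) \<and>
        (q < length (input_word d) \<and> input_word d ! q = Some (sym_code \<sigma> ! 1))))) \<longleftrightarrow>
      sym_at (fst d) \<sigma> (e i)"
  proof (cases "e i < length (fst d)")
    case True
    then have "input_word d ! (e i + e i) = Some (sym_code (fst d ! e i) ! 0)"
      and "input_word d ! Suc (e i + e i) = Some (sym_code (fst d ! e i) ! 1)"
      using nth_pair_word(1)[of "2 * e i" "code (fst d)" "snd d"]
        nth_pair_word(1)[of "2 * e i + 1" "code (fst d)" "snd d"]
        nth_code[OF True, of 0] nth_code[OF True, of 1]
      by (simp_all add: mult_2)
    with True show ?thesis
      unfolding sym_at_def sym_code_eq_iff by auto
  qed (auto simp: sym_at_def)
qed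

lemma definable_ex_sym:
  assumes "definable input_word (Suc k) (\<lambda>d e. R d (\<lambda>i. e (Suc i)) (e 0))"
  shows "definable input_word k (\<lambda>d e. \<exists>a<length (fst d). R d e a)"
proof (rule definable_cong)
  show "definable input_word k (\<lambda>d e. \<exists>a<length (input_word d). a < length (fst d) \<and> R d e a)"
    by (intro definable_intros definable_index assms) auto
next
  fix d :: "sym list \<times> bool list" and e
  show "(\<exists>a<length (input_word d). a < length (fst d) \<and> R d e a) \<longleftrightarrow> (\<exists>a<length (fst d). R d e a)"
  proof -
    have "a < length (input_word d)" if "a < length (fst d)" for a
      using that by simp
    then show ?thesis by blast
  qed
qed

lemma definable_all_sym:
  assumes "definable input_word (Suc k) (\<lambda>d e. R d (\<lambda>i. e (Suc i)) (e 0))"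
  shows "definable input_word k (\<lambda>d e. \<forall>a<length (fst d). R d e a)"
  using definable_not[OF definable_ex_sym[where R = "\<lambda>d e a. \<not> R d e a", OF definable_not[OF assms]]]
  by simp

text \<open>
  The premises are three levels down because the proof binds the two numbers before it counts.
\<close>

lemma definable_card_le:
  assumes "definable input_word (Suc (Suc (Suc k)))
      (\<lambda>d e. P d (\<lambda>i. e (Suc (Suc (Suc i)))) (e 0))"
    and "definable input_word (Suc (Suc (Suc k)))
      (\<lambda>d e. Q d (\<lambda>i. e (Suc (Suc (Suc i)))) (e 0))"
  shows "definable input_word k (\<lambda>d e.
    card {a. a < length (fst d) \<and> P d e a} \<le> 2 * card {a. a < length (fst d) \<and> Q d e a})"
proof (rule definable_cong)
  show "definable input_word k (\<lambda>d e. \<exists>m<length (input_word d). \<exists>n<length (input_word d).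
      card {a. a < length (input_word d) \<and> a < length (fst d) \<and> P d e a} = m \<and>
      card {a. a < length (input_word d) \<and> a < length (fst d) \<and> Q d e a} = n \<and>
      (m \<le> n \<or> (\<exists>t<m. n + t = m \<and> t \<le> n)))"
    by (intro definable_intros definable_count definable_index assms) auto
next
  fix d :: "sym list \<times> bool list" and e
  have *: "{a. a < length (input_word d) \<and> a < length (fst d) \<and> S a} = {a. a < length (fst d) \<and> S a}"
    for S by auto
  have c: "card {a. a < length (fst d) \<and> S a} < length (input_word d)" for S
  proof -
    have "card {a. a < length (fst d) \<and> S a} \<le> card {..<length (fst d)}"
      by (rule card_mono) auto
    then show ?thesis by simp
  qed
  \<comment> \<open>The inequality is expressed without forming \<open>2 * n\<close>: if
    \<open>m\<close> exceeds \<open>n\<close>, then the excess \<open>t\<close> must be at most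
    \<open>n\<close>.\<close>
  have le: "(m \<le> n \<or> (\<exists>t<m. n + t = m \<and> t \<le> n)) \<longleftrightarrow> m \<le> 2 * n" for m n :: nat
  proof
    assume "m \<le> 2 * n"
    then have "m \<le> n \<or> (m - n < m \<and> n + (m - n) = m \<and> m - n \<le> n)" by linarith
    then show "m \<le> n \<or> (\<exists>t<m. n + t = m \<and> t \<le> n)" by blast
  qed auto
  have ex: "(\<exists>m<N. \<exists>n<N. A = m \<and> B = n \<and> S m n) \<longleftrightarrow> S A B"
    if "A < N" "B < N" for A B N :: nat and S
    using that by auto
  show "(\<exists>m<length (input_word d). \<exists>n<length (input_word d).
      card {a. a < length (input_word d) \<and> a < length (fst d) \<and> P d e a} = m \<and>
      card {a. a < length (input_word d) \<and> a < length (fst d) \<and> Q d e a} = n \<and>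
      (m \<le> n \<or> (\<exists>t<m. n + t = m \<and> t \<le> n))) \<longleftrightarrow>
    card {a. a < length (fst d) \<and> P d e a} \<le> 2 * card {a. a < length (fst d) \<and> Q d e a}"
    unfolding * le by (rule ex[OF c c])
qed

text \<open>
  A guess is read as a sequence of numbers of \<open>l\<close> bits each. The length \<open>l\<close> is itself existentially
  quantified in the formula, so it need not be computed.
\<close>

definition guessed :: "bool list \<Rightarrow> nat \<Rightarrow> nat \<Rightarrow> bool" where
  "guessed y l p \<longleftrightarrow> 0 < l \<and>
     (\<exists>i. \<forall>j<l. i * l + j < length y \<and> (y ! (i * l + j) \<longleftrightarrow> bit p j))"

lemma definable_guessed:
  assumes "i < k" "j < k"
  shows "definable input_word k (\<lambda>d e. guessed (snd d) (e i) (e j))"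
proof (rule definable_cong)
  let ?n = "\<lambda>d. length (input_word d)"
  \<comment> \<open>\<open>h\<close> is the number of the block, \<open>m\<close> the separator,
    \<open>b\<close> the offset of the block in the guess and \<open>c\<close> the position just
    before its first bit. Hence bit \<open>t\<close> of the block stands at
    \<open>Suc (c + t)\<close>.\<close>
  let ?F = "\<lambda>d e. \<not> e i = 0 \<and> (\<exists>h<?n d. \<exists>m<?n d. \<exists>b<?n d. \<exists>c<?n d.
      m = 2 * length (fst d) \<and> h * e i = b \<and> m + b = c \<and>
      (\<forall>t<e i. \<exists>u<?n d. Suc (c + t) = u \<and>
        ((u < ?n d \<and> input_word d ! u = Some True) \<longleftrightarrow> bit (e j) t)))"
  show "definable input_word k ?F"
    by (intro definable_intros definable_separator definable_Suc_plus) (use assms in auto)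
  fix d :: "sym list \<times> bool list" and e :: "nat \<Rightarrow> nat"
  let ?y = "snd d" and ?l = "e i"
  have nth: "2 * length (fst d) + h * ?l + t + 1 < ?n d \<longleftrightarrow> h * ?l + t < length ?y"
    "h * ?l + t < length ?y \<Longrightarrow> input_word d ! Suc (2 * length (fst d) + h * ?l + t) = Some (?y ! (h * ?l + t))" for h t
    using nth_pair_word(3)[of "h * ?l + t" ?y "code (fst d)"] by (auto simp: add.assoc)
  show "?F d e \<longleftrightarrow> guessed ?y ?l (e j)"
  proof
    assume "?F d e"
    then obtain h where "?l \<noteq> 0"
      and h: "\<forall>t<?l. \<exists>u<?n d. Suc (2 * length (fst d) + h * ?l + t) = u \<and>
        ((u < ?n d \<and> input_word d ! u = Some True) \<longleftrightarrow> bit (e j) t)"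
      by blast
    have "h * ?l + t < length ?y \<and> (?y ! (h * ?l + t) \<longleftrightarrow> bit (e j) t)" if "t < ?l" for t
    proof -
      let ?u = "Suc (2 * length (fst d) + h * ?l + t)"
      have u: "?u < ?n d" "input_word d ! ?u = Some True \<longleftrightarrow> bit (e j) t"
        using h that by blast+
      from u(1) have "h * ?l + t < length ?y" by simp
      with nth(2) u(2) show ?thesis by simp
    qed
    with \<open>?l \<noteq> 0\<close> show "guessed ?y ?l (e j)"
      unfolding guessed_def by blast
  next
    assume "guessed ?y ?l (e j)"
    then obtain h where l: "?l > 0"
      and h: "\<And>t. t < ?l \<Longrightarrow> h * ?l + t < length ?y \<and> (?y ! (h * ?l + t) \<longleftrightarrow> bit (e j) t)"
      unfolding guessed_def by blast
    \<comment> \<open>Because \<open>?l\<close> is positive, \<open>h \<le> h * ?l\<close>; so the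
      block number itself is small enough to be quantified as a position.\<close>
    have "h * ?l < length ?y" using h[OF l] by simp
    moreover from this have "h < length ?y"
      using l by (intro le_less_trans[of h "h * ?l"]) simp_all
    ultimately have b: "h < ?n d" "h * ?l < ?n d" "2 * length (fst d) < ?n d"
      "2 * length (fst d) + h * ?l < ?n d" by simp_all
    have u: "Suc (2 * length (fst d) + h * ?l + t) < ?n d"
      "(Suc (2 * length (fst d) + h * ?l + t) < ?n d \<and>
        input_word d ! Suc (2 * length (fst d) + h * ?l + t) = Some True) \<longleftrightarrow> bit (e j) t"
      if "t < ?l" for t
      using h[OF that] nth[of h t] by simp_all
    show "?F d e"
    proof (intro conjI exI allI impI)
      show "2 * length (fst d) + h * ?l = 2 * length (fst d) + h * ?l" ..
    qed ((rule u, assumption) | rule b refl | (use l in simp))+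
  qed
qed

section \<open>The checking formula\<close>

text \<open>
  A vertex occurrence is identified with the position of its end-of-vertex mark and an edge with
  the position of its end-of-edge mark. Digits are numbered backwards from the end-of-vertex mark.
\<close>

definition digit_at :: "sym list \<Rightarrow> nat \<Rightarrow> bool" where
  "digit_at s q \<longleftrightarrow> sym_at s (Dig False) q \<or> sym_at s (Dig True) q"

definition digit_before :: "sym list \<Rightarrow> nat \<Rightarrow> nat \<Rightarrow> bool \<Rightarrow> bool" where
  "digit_before s q j b \<longleftrightarrow>
     (\<exists>p<q. Suc (p + j) = q \<and> sym_at s (Dig b) p \<and> (\<forall>t<q. p \<le> t \<longrightarrow> digit_at s t))"

text \<open>Both digit values are compared because an index beyond the numeral has neither;
  agreement of the lengths is thereby included.\<close>

definition same_vertex :: "sym list \<Rightarrow> nat \<Rightarrow> nat \<Rightarrow> bool" where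
  "same_vertex s p q \<longleftrightarrow> (\<forall>j<length s.
     (digit_before s p j False \<longleftrightarrow> digit_before s q j False) \<and>
     (digit_before s p j True \<longleftrightarrow> digit_before s q j True))"

text \<open>\<open>r\<close> need not be an end-of-edge mark. For other \<open>r\<close> these are
  the completed vertices of the edge still open at \<open>r\<close>, which the induction over
  prefixes needs.\<close>

definition occurs_at :: "sym list \<Rightarrow> nat \<Rightarrow> nat \<Rightarrow> bool" where
  "occurs_at s q r \<longleftrightarrow> q < r \<and> sym_at s EV q \<and> (\<forall>t<r. q \<le> t \<longrightarrow> \<not> sym_at s EE t)"

definition vertex_in :: "sym list \<Rightarrow> nat \<Rightarrow> nat \<Rightarrow> bool" where
  "vertex_in s q r \<longleftrightarrow> (\<exists>p<r. occurs_at s p r \<and> same_vertex s p q)"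

definition empty_edge_at :: "sym list \<Rightarrow> nat \<Rightarrow> bool" where
  "empty_edge_at s r \<longleftrightarrow> sym_at s EE r \<and> (\<forall>q<r. \<not> occurs_at s q r)"

text \<open>Empty edges act as terminators, so the edges before the first of them form the first
  hypergraph.\<close>

definition left_edge :: "sym list \<Rightarrow> nat \<Rightarrow> bool" where
  "left_edge s r \<longleftrightarrow> sym_at s EE r \<and> \<not> empty_edge_at s r \<and> (\<forall>a<r. \<not> empty_edge_at s a)"

definition right_edge :: "sym list \<Rightarrow> nat \<Rightarrow> bool" where
  "right_edge s r \<longleftrightarrow> sym_at s EE r \<and> \<not> empty_edge_at s r \<and> (\<exists>a<r. empty_edge_at s a)"

text \<open>The forbidden neighbours are an unfinished numeral at the end of an edge and, digits
  being listed from the least significant one, a leading zero.\<close>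

definition local_ok :: "sym list \<Rightarrow> bool" where
  "local_ok s \<longleftrightarrow> (\<forall>p<length s. \<forall>q<length s. Suc p = q \<longrightarrow>
     (digit_at s p \<longrightarrow> \<not> sym_at s EE q) \<and> (sym_at s (Dig False) p \<longrightarrow> \<not> sym_at s EV q))"

text \<open>\<open>a\<close> and \<open>b\<close> are the two terminators, \<open>b\<close> being
  the last symbol. The last two conjuncts make both hypergraphs non-empty.\<close>

definition two_parts :: "sym list \<Rightarrow> bool" where
  "two_parts s \<longleftrightarrow> (\<exists>a<length s. \<exists>b<length s.
     empty_edge_at s a \<and> empty_edge_at s b \<and> a < b \<and> (\<forall>r<length s. r \<le> b) \<and>
     (\<forall>r<length s. empty_edge_at s r \<longrightarrow> r = a \<or> r = b) \<and>
     (\<exists>r<a. sym_at s EE r) \<and> (\<exists>r<b. a < r \<and> sym_at s EE r))"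

definition edges_distinct :: "sym list \<Rightarrow> bool" where
  "edges_distinct s \<longleftrightarrow> (\<forall>r<length s. \<forall>r'<length s.
     (left_edge s r \<and> left_edge s r' \<or> right_edge s r \<and> right_edge s r') \<and>
     (\<forall>q<r. occurs_at s q r \<longrightarrow> vertex_in s q r') \<and>
     (\<forall>q<r'. occurs_at s q r' \<longrightarrow> vertex_in s q r) \<longrightarrow> r = r')"

definition vertices_distinct :: "sym list \<Rightarrow> bool" where
  "vertices_distinct s \<longleftrightarrow> (\<forall>r<length s. sym_at s EE r \<longrightarrow>
     (\<forall>p<r. \<forall>q<r. occurs_at s p r \<and> occurs_at s q r \<and> same_vertex s p q \<longrightarrow> p = q))"

text \<open>The vertex set is not part of the input. It is read off as the set of all named
  vertices, each of which must then be covered by both hypergraphs.\<close>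

definition covering :: "sym list \<Rightarrow> bool" where
  "covering s \<longleftrightarrow> (\<forall>q<length s. sym_at s EV q \<longrightarrow>
     (\<exists>r<length s. left_edge s r \<and> vertex_in s q r) \<and>
     (\<exists>r<length s. right_edge s r \<and> vertex_in s q r))"

definition well_formed :: "sym list \<Rightarrow> bool" where
  "well_formed s \<longleftrightarrow> local_ok s \<and> two_parts s \<and> edges_distinct s \<and> vertices_distinct s \<and> covering s"

text \<open>Minimality appears in the first-order form given by \<open>mem_tr_iff\<close>: each
  vertex of the set has an edge that meets the set in this vertex only.\<close>

definition minimal_transversal_at :: "sym list \<Rightarrow> nat \<Rightarrow> bool" where
  "minimal_transversal_at s r \<longleftrightarrow>
     (\<forall>g<length s. left_edge s g \<longrightarrow> (\<exists>q<g. occurs_at s q g \<and> vertex_in s q r)) \<and>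
     (\<forall>q<r. occurs_at s q r \<longrightarrow> (\<exists>g<length s. left_edge s g \<and>
       (\<forall>p<g. occurs_at s p g \<and> vertex_in s p r \<longrightarrow> same_vertex s p q)))"

text \<open>For the vertex \<open>v\<close> occurring at \<open>p\<close>, the first disjunct
  excludes \<open>{v}\<close> and the second \<open>g - {v}\<close>.\<close>

definition excluded_by :: "sym list \<Rightarrow> nat \<Rightarrow> nat \<Rightarrow> bool" where
  "excluded_by s p q \<longleftrightarrow>
     (\<exists>r<length s. right_edge s r \<and> occurs_at s p r \<and> same_vertex s p q) \<or>
     (\<exists>r<length s. left_edge s r \<and> occurs_at s p r \<and> vertex_in s q r \<and> \<not> same_vertex s p q)"

definition excluded :: "sym list \<Rightarrow> bool list \<Rightarrow> nat \<Rightarrow> nat \<Rightarrow> bool" where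
  "excluded s y l q \<longleftrightarrow> (\<exists>p<length s. guessed y l p \<and> excluded_by s p q)"

definition remaining :: "sym list \<Rightarrow> bool list \<Rightarrow> nat \<Rightarrow> nat \<Rightarrow> bool" where
  "remaining s y l r \<longleftrightarrow> right_edge s r \<and> (\<forall>q<r. occurs_at s q r \<longrightarrow> \<not> excluded s y l q)"

definition frequent :: "sym list \<Rightarrow> bool list \<Rightarrow> nat \<Rightarrow> nat \<Rightarrow> bool" where
  "frequent s y l q \<longleftrightarrow> \<not> excluded s y l q \<and>
     card {r. r < length s \<and> remaining s y l r} \<le>
       2 * card {r. r < length s \<and> (remaining s y l r \<and> vertex_in s q r)}"

definition frequent_witness :: "sym list \<Rightarrow> bool list \<Rightarrow> nat \<Rightarrow> bool" where
  "frequent_witness s y l \<longleftrightarrow>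
     (\<forall>r<length s. left_edge s r \<longrightarrow> (\<exists>q<r. occurs_at s q r \<and> frequent s y l q)) \<and>
     (\<forall>r<length s. right_edge s r \<longrightarrow> (\<exists>q<r. occurs_at s q r \<and> \<not> frequent s y l q))"

text \<open>No condition ties \<open>l\<close> to the guess: any \<open>l\<close> for which the
  frequent vertices form a witness proves non-duality.\<close>

definition accepts :: "sym list \<times> bool list \<Rightarrow> bool" where
  "accepts d \<longleftrightarrow> well_formed (fst d) \<and>
     ((\<exists>r<length (fst d). right_edge (fst d) r \<and> \<not> minimal_transversal_at (fst d) r) \<or>
      (\<exists>l<length (pair_word (code (fst d)) (snd d)). frequent_witness (fst d) (snd d) l))"

section \<open>Definability of the checking predicates\<close>

named_theorems dfn

text \<open>The rules follow the syntax of the definitions; what remains of each goal are bounds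
  \<open>i < k\<close> on indices.\<close>

lemmas [dfn] = definable_intros definable_all_sym definable_ex_sym definable_sym_at
  definable_Suc_plus definable_guessed definable_card_le

lemma definable_digit_at [dfn]:
  "i < k \<Longrightarrow> definable input_word k (\<lambda>d e. digit_at (fst d) (e i))"
  unfolding digit_at_def by (intro dfn) auto

lemma definable_digit_before:
  "i < k \<Longrightarrow> j < k \<Longrightarrow> definable input_word k (\<lambda>d e. digit_before (fst d) (e i) (e j) b)"
  unfolding digit_before_def by (intro dfn) auto

lemma definable_same_vertex [dfn]:
  "i < k \<Longrightarrow> j < k \<Longrightarrow> definable input_word k (\<lambda>d e. same_vertex (fst d) (e i) (e j))"
  unfolding same_vertex_def by (intro dfn definable_digit_before) auto

lemma definable_occurs_at [dfn]:
  "i < k \<Longrightarrow> j < k \<Longrightarrow> definable input_word k (\<lambda>d e. occurs_at (fst d) (e i) (e j))"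
  unfolding occurs_at_def by (intro dfn) auto

lemma definable_vertex_in [dfn]:
  "i < k \<Longrightarrow> j < k \<Longrightarrow> definable input_word k (\<lambda>d e. vertex_in (fst d) (e i) (e j))"
  unfolding vertex_in_def by (intro dfn) auto

lemma definable_empty_edge_at [dfn]:
  "i < k \<Longrightarrow> definable input_word k (\<lambda>d e. empty_edge_at (fst d) (e i))"
  unfolding empty_edge_at_def by (intro dfn) auto

lemma definable_left_edge [dfn]:
  "i < k \<Longrightarrow> definable input_word k (\<lambda>d e. left_edge (fst d) (e i))"
  unfolding left_edge_def by (intro dfn) auto

lemma definable_right_edge [dfn]:
  "i < k \<Longrightarrow> definable input_word k (\<lambda>d e. right_edge (fst d) (e i))"
  unfolding right_edge_def by (intro dfn) auto

lemma definable_well_formed: "definable input_word 0 (\<lambda>d e. well_formed (fst d))"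
  unfolding well_formed_def local_ok_def two_parts_def edges_distinct_def vertices_distinct_def covering_def
  by (intro dfn) auto

lemma definable_minimal_transversal_at [dfn]:
  "i < k \<Longrightarrow> definable input_word k (\<lambda>d e. minimal_transversal_at (fst d) (e i))"
  unfolding minimal_transversal_at_def by (intro dfn) auto

lemma definable_excluded_by [dfn]:
  "i < k \<Longrightarrow> j < k \<Longrightarrow> definable input_word k (\<lambda>d e. excluded_by (fst d) (e i) (e j))"
  unfolding excluded_by_def by (intro dfn) auto

lemma definable_excluded [dfn]:
  "i < k \<Longrightarrow> j < k \<Longrightarrow> definable input_word k (\<lambda>d e. excluded (fst d) (snd d) (e i) (e j))"
  unfolding excluded_def by (intro dfn) auto

lemma definable_remaining [dfn]:
  "i < k \<Longrightarrow> j < k \<Longrightarrow> definable input_word k (\<lambda>d e. remaining (fst d) (snd d) (e i) (e j))"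
  unfolding remaining_def by (intro dfn) auto

lemma definable_frequent [dfn]:
  "i < k \<Longrightarrow> j < k \<Longrightarrow> definable input_word k (\<lambda>d e. frequent (fst d) (snd d) (e i) (e j))"
  unfolding frequent_def by (intro dfn) auto

lemma definable_frequent_witness [dfn]:
  "i < k \<Longrightarrow> definable input_word k (\<lambda>d e. frequent_witness (fst d) (snd d) (e i))"
  unfolding frequent_witness_def by (intro dfn) auto

lemma definable_accepts: "definable input_word 0 (\<lambda>d e. accepts d)"
  unfolding accepts_def by (intro dfn definable_well_formed) auto

lemma accepts_TC0: "{pair_word (code s) y | s y. accepts (s, y)} \<in> TC0"
proof -
  have "{input_word d | d. accepts d} \<in> TC0"
    by (rule TC0_if_definable[OF definable_range_input_word definable_accepts])
  then show ?thesis by simp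
qed

section \<open>Parsing\<close>

text \<open>
  The parsing functions take the part of the word read so far in reverse, so that properties of
  prefixes follow by induction on their length.
\<close>

fun trailing_digits :: "sym list \<Rightarrow> bool list" where
  "trailing_digits (Dig b # t) = trailing_digits t @ [b]"
| "trailing_digits _ = []"

fun open_edge :: "sym list \<Rightarrow> bool list list" where
  "open_edge (EV # t) = open_edge t @ [trailing_digits t]"
| "open_edge (Dig b # t) = open_edge t"
| "open_edge _ = []"

fun closed_edges :: "sym list \<Rightarrow> bool list list list" where
  "closed_edges (EE # t) = closed_edges t @ [open_edge t]"
| "closed_edges (_ # t) = closed_edges t"
| "closed_edges [] = []"

definition vertex_syms :: "bool list \<Rightarrow> sym list" where
  "vertex_syms bs = map Dig bs @ [EV]"

definition edge_syms :: "bool list list \<Rightarrow> sym list" where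
  "edge_syms e = concat (map vertex_syms e) @ [EE]"

definition name_at :: "sym list \<Rightarrow> nat \<Rightarrow> bool list" where
  "name_at s q = trailing_digits (rev (take q s))"

definition names_at :: "sym list \<Rightarrow> nat \<Rightarrow> bool list list" where
  "names_at s r = open_edge (rev (take r s))"

lemma digit_before_Suc:
  assumes "q < length s"
  shows "digit_before s (Suc q) 0 b \<longleftrightarrow> s ! q = Dig b"
    and "digit_before s (Suc q) (Suc j) b \<longleftrightarrow> (\<exists>c. s ! q = Dig c) \<and> digit_before s q j b"
proof -
  have d: "digit_at s q \<longleftrightarrow> (\<exists>c. s ! q = Dig c)"
    using assms by (auto simp: digit_at_def sym_at_def ex_bool_eq)
  show "digit_before s (Suc q) 0 b \<longleftrightarrow> s ! q = Dig b"
    unfolding digit_before_def using assms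
    by (auto simp: sym_at_def d less_Suc_eq)
  show "digit_before s (Suc q) (Suc j) b \<longleftrightarrow> (\<exists>c. s ! q = Dig c) \<and> digit_before s q j b"
    unfolding digit_before_def d[symmetric] by (auto simp: less_Suc_eq)
qed

lemma name_at_Suc:
  "q < length s \<Longrightarrow> name_at s (Suc q) = (case s ! q of Dig b \<Rightarrow> name_at s q @ [b] | _ \<Rightarrow> [])"
  by (auto simp: name_at_def take_Suc_conv_app_nth split: sym.split)

lemma names_at_Suc:
  "r < length s \<Longrightarrow> names_at s (Suc r) =
     (case s ! r of Dig b \<Rightarrow> names_at s r | EV \<Rightarrow> names_at s r @ [name_at s r] | EE \<Rightarrow> [])"
  by (auto simp: name_at_def names_at_def take_Suc_conv_app_nth split: sym.split)

text \<open>Both sides obey the same recursion in \<open>q\<close>, given by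
  \<open>digit_before_Suc\<close> and \<open>name_at_Suc\<close>; \<open>rev\<close> accounts for
  the backward numbering of digits.\<close>

lemma digit_before_iff:
  "q \<le> length s \<Longrightarrow>
    digit_before s q j b \<longleftrightarrow> j < length (name_at s q) \<and> rev (name_at s q) ! j = b"
proof (induction q arbitrary: j)
  case 0
  then show ?case by (simp add: digit_before_def name_at_def)
next
  case (Suc q)
  then show ?case
    by (cases j) (auto simp: digit_before_Suc name_at_Suc split: sym.split)
qed

lemma length_name_at: "q \<le> length s \<Longrightarrow> length (name_at s q) \<le> q"
proof (induction q)
  case (Suc q)
  then show ?case by (auto simp: name_at_Suc split: sym.split)
qed (simp add: name_at_def)

lemma same_vertex_iff:
  assumes "p \<le> length s" "q \<le> length s"
  shows "same_vertex s p q \<longleftrightarrow> name_at s p = name_at s q"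
proof
  assume *: "same_vertex s p q"
  have eq: "(j < length (name_at s p) \<and> rev (name_at s p) ! j = b) \<longleftrightarrow>
      (j < length (name_at s q) \<and> rev (name_at s q) ! j = b)" for j b
  proof (cases "j < length s")
    case True
    then show ?thesis
      using * unfolding same_vertex_def
      by (cases b) (simp_all only: digit_before_iff[OF assms(1)] digit_before_iff[OF assms(2)])
  next
    case False
    then show ?thesis
      using length_name_at[OF assms(1)] length_name_at[OF assms(2)] assms by linarith
  qed
  \<comment> \<open>If the lengths differed, then at the index given by the smaller one, one name
    would have a digit and the other none.\<close>
  then have "length (name_at s p) = length (name_at s q)"
    by (metis linorder_neqE_nat less_irrefl)
  then have "rev (name_at s p) = rev (name_at s q)"
    using eq by (intro nth_equalityI) auto
  then show "name_at s p = name_at s q" by simp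
next
  assume "name_at s p = name_at s q"
  then show "same_vertex s p q"
    unfolding same_vertex_def digit_before_iff[OF assms(1)] digit_before_iff[OF assms(2)] by simp
qed

text \<open>One more symbol changes both sides alike: \<open>EE\<close> clears the list,
  \<open>EV\<close> appends the completed name, and a digit leaves the list as it is.\<close>

lemma names_at_eq:
  "r \<le> length s \<Longrightarrow>
    names_at s r = map (name_at s) (filter (\<lambda>q. occurs_at s q r) [0..<r])"
proof (induction r)
  case 0
  then show ?case by (simp add: names_at_def)
next
  case (Suc r)
  have old: "occurs_at s q (Suc r) \<longleftrightarrow> occurs_at s q r \<and> s ! r \<noteq> EE" if "q < r" for q
    using that Suc.prems by (auto simp: occurs_at_def sym_at_def less_Suc_eq)
  have new: "occurs_at s r (Suc r) \<longleftrightarrow> s ! r = EV"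
    using Suc.prems by (auto simp: occurs_at_def sym_at_def less_Suc_eq)
  have "filter (\<lambda>q. occurs_at s q (Suc r)) [0..<r] =
      (if s ! r = EE then [] else filter (\<lambda>q. occurs_at s q r) [0..<r])"
    by (auto simp: old filter_empty_conv intro!: filter_cong)
  then show ?case
    using Suc by (auto simp: new names_at_Suc split: sym.split)
qed

lemma closed_edges_eq:
  "r \<le> length s \<Longrightarrow>
    closed_edges (rev (take r s)) = map (names_at s) (filter (sym_at s EE) [0..<r])"
proof (induction r)
  case (Suc r)
  then have "sym_at s EE r \<longleftrightarrow> s ! r = EE" by (simp add: sym_at_def)
  with Suc show ?case
    by (cases "s ! r") (auto simp: take_Suc_conv_app_nth names_at_def)
qed simp

lemma set_names_at:
  "r \<le> length s \<Longrightarrow> set (names_at s r) = name_at s ` {q. occurs_at s q r}"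
  by (auto simp: names_at_eq occurs_at_def)

lemma distinct_names_at_iff:
  "r \<le> length s \<Longrightarrow> distinct (names_at s r) \<longleftrightarrow> inj_on (name_at s) {q. occurs_at s q r}"
proof -
  have "{q. q < r \<and> occurs_at s q r} = {q. occurs_at s q r}"
    by (auto simp: occurs_at_def)
  then show "r \<le> length s \<Longrightarrow> ?thesis"
    by (simp add: names_at_eq distinct_map)
qed

lemma empty_edge_at_iff: "empty_edge_at s r \<longleftrightarrow> sym_at s EE r \<and> names_at s r = []"
  by (auto simp: empty_edge_at_def names_at_eq sym_at_def filter_empty_conv)

section \<open>Local syntax and inversion of the parser\<close>

definition follows :: "sym \<Rightarrow> sym \<Rightarrow> bool" where
  "follows \<sigma> \<tau> \<longleftrightarrow> ((\<exists>b. \<sigma> = Dig b) \<longrightarrow> \<tau> \<noteq> EE) \<and> (\<sigma> = Dig False \<longrightarrow> \<tau> \<noteq> EV)"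

lemma follows_delimiter [simp]: "follows EV \<tau>" "follows EE \<tau>"
  by (simp_all add: follows_def)

lemma local_ok_iff: "local_ok s \<longleftrightarrow> successively follows s"
proof -
  have d: "digit_at s p \<longleftrightarrow> p < length s \<and> (\<exists>b. s ! p = Dig b)" for p
    by (auto simp: digit_at_def sym_at_def ex_bool_eq)
  show ?thesis
    unfolding local_ok_def successively_conv_nth d sym_at_def follows_def
    by (auto dest: Suc_lessD)
qed

lemma trailing_digits_eq_Nil:
  assumes "successively follows (s @ [EE])" shows "trailing_digits (rev s) = []"
proof (cases s rule: rev_cases)
  case (snoc s' \<sigma>)
  with assms show ?thesis
    by (cases \<sigma>) (simp_all add: successively_append_iff follows_def)
qed simp

text \<open>The parsers lose digits only if these stand directly before an end-of-edge mark, and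
  \<open>follows\<close> forbids this; otherwise the closed edges, the open edge and the pending
  digits together retain the whole word.\<close>

lemma unparse:
  "successively follows s \<Longrightarrow>
    s = concat (map edge_syms (closed_edges (rev s))) @
      concat (map vertex_syms (open_edge (rev s))) @ map Dig (trailing_digits (rev s))"
proof (induction s rule: rev_induct)
  case (snoc \<sigma> s)
  then have "successively follows s" by (simp add: successively_append_iff)
  note IH = snoc.IH[OF this]
  show ?case
  proof (cases \<sigma>)
    case EE
    then have "trailing_digits (rev s) = []"
      using snoc.prems trailing_digits_eq_Nil by simp
    with EE IH show ?thesis by (simp add: edge_syms_def)
  qed (use IH in \<open>simp_all add: vertex_syms_def\<close>)
qed simp

lemma vertex_syms_nonempty [simp]: "vertex_syms bs \<noteq> []" "last (vertex_syms bs) = EV"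
  by (simp_all add: vertex_syms_def)

lemma edge_syms_nonempty [simp]: "edge_syms e \<noteq> []" "last (edge_syms e) = EE"
  by (simp_all add: edge_syms_def)

lemma trailing_digits_append:
  "trailing_digits (rev (map Dig bs) @ t) = trailing_digits t @ bs"
  by (induction bs rule: rev_induct) auto

lemma open_edge_vertex_syms:
  "trailing_digits t = [] \<Longrightarrow> open_edge (rev (vertex_syms bs) @ t) = open_edge t @ [bs]"
proof -
  have "open_edge (rev (map Dig bs) @ t) = open_edge t"
    by (induction bs rule: rev_induct) auto
  then show "trailing_digits t = [] \<Longrightarrow> ?thesis"
    by (simp add: vertex_syms_def trailing_digits_append)
qed

lemma closed_edges_vertex_syms: "closed_edges (rev (vertex_syms bs) @ t) = closed_edges t"
proof -
  have "closed_edges (rev (map Dig bs) @ t) = closed_edges t"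
    by (induction bs rule: rev_induct) auto
  then show ?thesis by (simp add: vertex_syms_def)
qed

lemma trailing_digits_vertex_syms: "trailing_digits (rev (vertex_syms bs) @ t) = []"
  by (simp add: vertex_syms_def)

text \<open>The absence of pending digits is an invariant: digits pending in \<open>t\<close> would
  become part of the first vertex read.\<close>

lemma parse_vertices:
  assumes "trailing_digits t = []"
  shows "trailing_digits (rev (concat (map vertex_syms e)) @ t) = [] \<and>
    open_edge (rev (concat (map vertex_syms e)) @ t) = open_edge t @ e \<and>
    closed_edges (rev (concat (map vertex_syms e)) @ t) = closed_edges t"
proof (induction e rule: rev_induct)
  case (snoc bs e)
  then show ?case
    using open_edge_vertex_syms[of "rev (concat (map vertex_syms e)) @ t" bs]
      closed_edges_vertex_syms[of bs "rev (concat (map vertex_syms e)) @ t"]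
    by (simp add: trailing_digits_vertex_syms)
qed (use assms in simp)

lemma closed_edges_unparse:
  "closed_edges (rev (concat (map edge_syms es))) = es \<and>
   trailing_digits (rev (concat (map edge_syms es))) = [] \<and>
   open_edge (rev (concat (map edge_syms es))) = []"
proof (induction es rule: rev_induct)
  case (snoc e es)
  then show ?case
    using parse_vertices[of "rev (concat (map edge_syms es))" e] by (simp add: edge_syms_def[of e])
qed simp

definition normal_numeral :: "bool list \<Rightarrow> bool" where
  "normal_numeral bs \<longleftrightarrow> bs = [] \<or> last bs"

text \<open>Only two borders can violate \<open>follows\<close>. The last digit before an
  \<open>EV\<close> is 1 in a normal numeral, and an \<open>EE\<close> either comes after an
  \<open>EV\<close> or forms an empty edge.\<close>

lemma successively_unparse:
  assumes "\<forall>e\<in>set es. \<forall>bs\<in>set e. normal_numeral bs"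
  shows "successively follows (concat (map edge_syms es))"
proof -
  have v: "successively follows (vertex_syms bs)" if "normal_numeral bs" for bs
  proof -
    have "successively follows (map Dig bs)"
      by (auto simp: successively_conv_nth follows_def)
    then show ?thesis
      using that
      by (auto simp: vertex_syms_def successively_append_iff normal_numeral_def follows_def last_map)
  qed
  have vs: "successively follows (concat (map vertex_syms e))" if "\<forall>bs\<in>set e. normal_numeral bs" for e
    using that
  proof (induction e)
    case (Cons bs e)
    then show ?case
      using v[of bs]
      by (subst list.map, subst concat.simps, subst successively_append_iff)
        auto
  qed simp
  have "last (concat (map vertex_syms e)) = EV" if "concat (map vertex_syms e) \<noteq> []" for e
    using that by (cases e rule: rev_cases) (auto simp: vertex_syms_def)
  then have e: "successively follows (edge_syms e)" if "\<forall>bs\<in>set e. normal_numeral bs" for e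
    using vs[OF that] by (auto simp: edge_syms_def successively_append_iff follows_def)
  show ?thesis
    using assms
  proof (induction es)
    case (Cons x es)
    then show ?case
      using e[of x]
      by (subst list.map, subst concat.simps, subst successively_append_iff) auto
  qed simp
qed

lemma last_name_at:
  "q \<le> length s \<Longrightarrow> name_at s q \<noteq> [] \<Longrightarrow> \<exists>p. q = Suc p \<and> s ! p = Dig (last (name_at s q))"
  by (cases q) (auto simp: name_at_Suc name_at_def[of _ 0] split: sym.splits)

text \<open>The last digit of a non-empty name is the symbol in front of the \<open>EV\<close>,
  where \<open>follows\<close> excludes a 0.\<close>

lemma normal_numeral_name_at:
  assumes "local_ok s" "sym_at s EV q" shows "normal_numeral (name_at s q)"
proof (rule ccontr)
  assume "\<not> normal_numeral (name_at s q)"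
  then obtain p where p: "q = Suc p" "s ! p = Dig False"
    using last_name_at[of q s] assms(2) by (auto simp: normal_numeral_def sym_at_def)
  then have "follows (s ! p) (s ! q)"
    using assms by (auto simp: local_ok_iff successively_conv_nth sym_at_def)
  then show False using p assms(2) by (simp add: follows_def sym_at_def)
qed

section \<open>Binary numerals and their values\<close>

fun numeral_value :: "bool list \<Rightarrow> nat" where
  "numeral_value [] = 0"
| "numeral_value (b # bs) = of_bool b + 2 * numeral_value bs"

lemma numeral_value_binary [simp]: "numeral_value (binary n) = n"
proof (induction n rule: binary.induct)
  case (1 n)
  then show ?case
    by (subst binary.simps) (auto simp: of_bool_odd_eq_mod_2)
qed

lemma normal_numeral_binary: "normal_numeral (binary n)"
proof (induction n rule: binary.induct)
  case (1 n)
  have "binary (n div 2) = [] \<longleftrightarrow> n div 2 = 0"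
    by (simp add: binary.simps[of "n div 2"])
  moreover have "odd n" if "n \<noteq> 0" "n div 2 = 0"
    using that by presburger
  ultimately show ?case
    using 1 by (cases "n = 0") (auto simp: binary.simps[of n] normal_numeral_def)
qed

lemma binary_numeral_value: "normal_numeral bs \<Longrightarrow> binary (numeral_value bs) = bs"
proof (induction bs)
  case (Cons b bs)
  then have "binary (numeral_value bs) = bs"
    by (auto simp: normal_numeral_def split: if_splits)
  moreover have "numeral_value (b # bs) \<noteq> 0"
    using Cons.prems calculation by (auto simp: normal_numeral_def binary.simps[of 0] split: if_splits)
  ultimately show ?case
    by (subst binary.simps) auto
qed (simp add: binary.simps)

text \<open>Names can therefore be compared in place of the numbers they denote.\<close>

lemma inj_on_numeral_value: "inj_on numeral_value {bs. normal_numeral bs}"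
  by (metis (mono_tags) binary_numeral_value inj_onI mem_Collect_eq)

lemma code_vertex_syms: "code (vertex_syms (binary v)) = enc_vertex v"
proof -
  have "code (map Dig bs) = concat (map digit bs)" for bs
    by (induction bs) auto
  then show ?thesis by (simp add: vertex_syms_def enc_vertex_def)
qed

lemma code_edge_syms: "code (edge_syms (map binary e)) = enc_edge e"
proof -
  have "code (concat (map vertex_syms (map binary e))) = concat (map enc_vertex e)"
    by (induction e) (auto simp: code_vertex_syms)
  then show ?thesis by (simp add: edge_syms_def enc_edge_def)
qed

lemma code_unparse:
  "code (concat (map edge_syms (map (map binary) es))) = concat (map enc_edge es)"
  by (induction es) (auto simp: code_edge_syms)

section \<open>Short certificates of non-duality\<close>

definition missing :: "'v set set \<Rightarrow> 'v set \<Rightarrow> 'v set set" where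
  "missing H X = {h\<in>H. h \<inter> X = {}}"

definition frequent_vertices :: "'v set \<Rightarrow> 'v set set \<Rightarrow> 'v set \<Rightarrow> 'v set" where
  "frequent_vertices V H X =
     {v\<in>V. v \<notin> X \<and> card (missing H X) \<le> 2 * card {h\<in>missing H X. v \<in> h}}"

definition pieces :: "'v set \<Rightarrow> 'v set set \<Rightarrow> 'v set set" where
  "pieces V G = {{v} | v. v \<in> V} \<union> {g - {v} | g v. g \<in> G \<and> v \<in> g}"

definition new_transversal :: "'v set \<Rightarrow> 'v set set \<Rightarrow> 'v set set \<Rightarrow> 'v set \<Rightarrow> bool" where
  "new_transversal V G H T \<longleftrightarrow> transversal V G T \<and> (\<forall>h\<in>H. \<not> h \<subseteq> T)"

text \<open>Removing \<open>v\<close> destroys a transversal exactly if some edge meets it in no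
  other vertex. A proper subset lacks some \<open>v\<close> and so misses the edge belonging to
  \<open>v\<close>.\<close>

lemma mem_tr_iff:
  "T \<in> tr V G \<longleftrightarrow> transversal V G T \<and> (\<forall>v\<in>T. \<exists>g\<in>G. g \<inter> T \<subseteq> {v})"
proof
  assume T: "T \<in> tr V G"
  have "\<exists>g\<in>G. g \<inter> T \<subseteq> {v}" if "v \<in> T" for v
  proof -
    have "T - {v} \<subset> T" using that by auto
    then have "\<not> transversal V G (T - {v})"
      using T by (auto simp: tr_def)
    then show ?thesis using T by (fastforce simp: tr_def transversal_def)
  qed
  with T show "transversal V G T \<and> (\<forall>v\<in>T. \<exists>g\<in>G. g \<inter> T \<subseteq> {v})"
    by (simp add: tr_def)
next
  assume T: "transversal V G T \<and> (\<forall>v\<in>T. \<exists>g\<in>G. g \<inter> T \<subseteq> {v})"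
  have "\<not> transversal V G T'" if sub: "T' \<subset> T" for T'
  proof -
    obtain v where v: "v \<in> T" "v \<notin> T'" using sub by blast
    then obtain g where "g \<in> G" "g \<inter> T \<subseteq> {v}" using T by blast
    then have "T' \<inter> g = {}" using v sub by blast
    with \<open>g \<in> G\<close> show ?thesis by (auto simp: transversal_def)
  qed
  with T show "T \<in> tr V G" by (simp add: tr_def)
qed

lemma ex_minimal_transversal:
  assumes "finite V" "transversal V G T"
  shows "\<exists>T'\<in>tr V G. T' \<subseteq> T"
proof -
  obtain T' where T': "T' \<subseteq> T \<and> transversal V G T'"
    and min: "\<And>S. S \<subseteq> T \<and> transversal V G S \<Longrightarrow> card T' \<le> card S"
    using ex_has_least_nat[of "\<lambda>S. S \<subseteq> T \<and> transversal V G S" T card] assms(2) by auto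
  have "finite T'"
    using T' assms(1) by (auto simp: transversal_def intro: finite_subset)
  then have "\<not> transversal V G S" if "S \<subset> T'" for S
    using that min[of S] T' psubset_card_mono[of T' S] by auto
  with T' show ?thesis unfolding tr_def by blast
qed

text \<open>\<open>T\<close> need not be minimal: a minimal transversal inside \<open>T\<close>
  contains no edge of \<open>H\<close> either, so it is not an edge of \<open>H\<close>.\<close>

lemma not_dual_if_new_transversal:
  assumes "finite V" "new_transversal V G H T"
  shows "\<not> dual V G H"
  using ex_minimal_transversal[of V G T] assms by (auto simp: new_transversal_def dual_def)

text \<open>If all edges of \<open>H\<close> are minimal transversals, then a minimal transversal
  outside \<open>H\<close> contains none of them, because distinct minimal transversals are
  incomparable.\<close>

lemma not_dual_cases:
  assumes "\<not> dual V G H"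
  obtains h where "h \<in> H" "h \<notin> tr V G"
  | T where "H \<subseteq> tr V G" "T \<in> tr V G" "new_transversal V G H T"
proof (cases "H \<subseteq> tr V G")
  case True
  then obtain T where T: "T \<in> tr V G" "T \<notin> H"
    using assms by (auto simp: dual_def)
  have "\<not> h \<subseteq> T" if "h \<in> H" for h
    using that T True by (auto simp: tr_def)
  then show thesis
    using that(2)[OF True T(1)] T by (simp add: new_transversal_def tr_def)
qed (use that(1) in blast)

text \<open>
  \<open>X\<close> stays disjoint from \<open>T\<close>. If \<open>v\<close> is an infrequent vertex of \<open>T\<close>, minimality yields an edge \<open>g\<close>
  that meets \<open>T\<close> only in \<open>v\<close>. As the edges of \<open>H\<close> meet \<open>g\<close>, those missing \<open>g - {v}\<close> contain \<open>v\<close>, and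
  so adding \<open>g - {v}\<close> halves their number.
\<close>

lemma short_certificate:
  assumes fin: "finite V" and HV: "H \<subseteq> Pow V" and cross: "H \<subseteq> tr V G"
    and T: "T \<in> tr V G" "new_transversal V G H T"
  shows "X \<inter> T = {} \<Longrightarrow> card (missing H X) < 2 ^ k \<Longrightarrow>
    \<exists>ps. length ps \<le> k \<and> set ps \<subseteq> pieces V G \<and>
      new_transversal V G H (frequent_vertices V H (X \<union> \<Union> (set ps)))"
proof (induction k arbitrary: X)
  have finH: "finite H"
    using fin HV by (meson finite_Pow_iff finite_subset)
  {
    case 0
    then have "missing H X = {}"
      using finH by (simp add: missing_def)
    \<comment> \<open>With no edge left, the counting condition reads \<open>0 \<le> 0\<close> and
      holds for every vertex outside \<open>X\<close>.\<close>
    then have F: "frequent_vertices V H X = V - X"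
      by (auto simp: frequent_vertices_def)
    have "\<not> h \<subseteq> V - X" if "h \<in> H" for h
      using \<open>missing H X = {}\<close> that unfolding missing_def by blast
    moreover have "T \<subseteq> V - X"
      using T(2) 0(1) unfolding new_transversal_def transversal_def by blast
    moreover have "T \<inter> g \<noteq> {}" if "g \<in> G" for g
      using T(2) that unfolding new_transversal_def transversal_def by blast
    ultimately have "new_transversal V G H (frequent_vertices V H X)"
      unfolding F new_transversal_def transversal_def by blast
    then show ?case by (intro exI[of _ "[]"]) simp
  next
    case (Suc k)
    let ?F = "frequent_vertices V H X"
    have finM: "finite (missing H X)" using finH by (simp add: missing_def)
    have TV: "T \<subseteq> V" using T(1) by (auto simp: tr_def transversal_def)
    \<comment> \<open>It suffices to find a piece that avoids \<open>T\<close> and halves the number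
      of edges missing \<open>X\<close>; the induction hypothesis for \<open>X \<union> p\<close>
      supplies the rest of the list.\<close>
    have step: ?case
      if p: "p \<in> pieces V G" "p \<inter> T = {}" and c: "2 * card (missing H (X \<union> p)) \<le> card (missing H X)" for p
    proof -
      have "(X \<union> p) \<inter> T = {}" using p(2) Suc.prems(1) by blast
      moreover have "card (missing H (X \<union> p)) < 2 ^ k" using c Suc.prems(2) by simp
      ultimately obtain ps where "length ps \<le> k" "set ps \<subseteq> pieces V G"
        "new_transversal V G H (frequent_vertices V H (X \<union> p \<union> \<Union> (set ps)))"
        using Suc.IH by blast
      then show ?thesis
        using p(1) by (intro exI[of _ "p # ps"]) (simp add: Un_assoc)
    qed
    consider "?F = T" | v where "v \<in> ?F" "v \<notin> T" | v where "v \<in> T" "v \<notin> ?F"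
      by blast
    then show ?case
    proof cases
      case 1
      with T(2) show ?thesis by (intro exI[of _ "[]"]) simp
    next
      case (2 v)
      \<comment> \<open>Excluding \<open>v\<close> drops exactly the edges through \<open>v\<close>,
        which by frequency are at least half of those counted.\<close>
      have "missing H (X \<union> {v}) = missing H X - {h\<in>missing H X. v \<in> h}"
        by (auto simp: missing_def)
      then have "card (missing H (X \<union> {v})) = card (missing H X) - card {h\<in>missing H X. v \<in> h}"
        using finM by (simp add: card_Diff_subset)
      moreover have "card (missing H X) \<le> 2 * card {h\<in>missing H X. v \<in> h}" "v \<in> V"
        using 2 by (auto simp: frequent_vertices_def)
      ultimately have "2 * card (missing H (X \<union> {v})) \<le> card (missing H X)"
        by linarith
      moreover have "{v} \<in> pieces V G" "{v} \<inter> T = {}"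
        using 2 \<open>v \<in> V\<close> by (auto simp: pieces_def)
      ultimately show ?thesis by (intro step)
    next
      case (3 v)
      obtain g where g: "g \<in> G" "g \<inter> T \<subseteq> {v}" using T(1) 3(1) by (auto simp: mem_tr_iff)
      moreover have "g \<inter> T \<noteq> {}"
        using T(1) g(1) by (auto simp: tr_def transversal_def)
      ultimately have gv: "v \<in> g" "(g - {v}) \<inter> T = {}" by auto
      have "h \<inter> g \<noteq> {}" if "h \<in> H" for h
        using cross that g(1) unfolding mem_tr_iff subset_iff transversal_def by blast
      then have "missing H (X \<union> (g - {v})) \<subseteq> {h\<in>missing H X. v \<in> h}"
        unfolding missing_def by blast
      then have "card (missing H (X \<union> (g - {v}))) \<le> card {h\<in>missing H X. v \<in> h}"
        using finM by (intro card_mono) auto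
      \<comment> \<open>\<open>v\<close> lies in \<open>V\<close> and, as \<open>X\<close> avoids
        \<open>T\<close>, not in \<open>X\<close>; so its infrequency can only come from the
        count.\<close>
      moreover have "2 * card {h\<in>missing H X. v \<in> h} < card (missing H X)"
        using 3 TV Suc.prems(1) by (auto simp: frequent_vertices_def)
      ultimately have "2 * card (missing H (X \<union> (g - {v}))) \<le> card (missing H X)"
        by linarith
      moreover have "g - {v} \<in> pieces V G"
        using g(1) gv(1) by (auto simp: pieces_def)
      ultimately show ?thesis using gv(2) by (intro step)
    qed
  }
qed

section \<open>The hypergraphs of a word\<close>

definition vertex_at :: "sym list \<Rightarrow> nat \<Rightarrow> nat" where
  "vertex_at s q = numeral_value (name_at s q)"

definition edge_list_at :: "sym list \<Rightarrow> nat \<Rightarrow> nat list" where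
  "edge_list_at s r = map numeral_value (names_at s r)"

definition edge_at :: "sym list \<Rightarrow> nat \<Rightarrow> nat set" where
  "edge_at s r = vertex_at s ` {q. occurs_at s q r}"

definition vertices :: "sym list \<Rightarrow> nat set" where
  "vertices s = vertex_at s ` {q. sym_at s EV q}"

definition left_edges :: "sym list \<Rightarrow> nat set set" where
  "left_edges s = edge_at s ` {r. left_edge s r}"

definition right_edges :: "sym list \<Rightarrow> nat set set" where
  "right_edges s = edge_at s ` {r. right_edge s r}"

lemma sym_at_less: "sym_at s \<sigma> q \<Longrightarrow> q < length s"
  by (simp add: sym_at_def)

lemma occurs_atD: "occurs_at s q r \<Longrightarrow> sym_at s EV q \<and> q < r"
  by (simp add: occurs_at_def)

text \<open>In front of an \<open>EV\<close> stands a normal numeral, and among these the value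
  determines the name.\<close>

lemma same_vertex_iff_vertex_at:
  assumes "local_ok s" "sym_at s EV p" "sym_at s EV q"
  shows "same_vertex s p q \<longleftrightarrow> vertex_at s p = vertex_at s q"
proof -
  have "same_vertex s p q \<longleftrightarrow> name_at s p = name_at s q"
    using assms by (intro same_vertex_iff) (auto dest: sym_at_less)
  then show ?thesis
    using inj_onD[OF inj_on_numeral_value, of "name_at s p" "name_at s q"]
      normal_numeral_name_at[OF assms(1,2)] normal_numeral_name_at[OF assms(1,3)]
    by (auto simp: vertex_at_def)
qed

lemma vertex_in_iff:
  assumes "local_ok s" "sym_at s EV q"
  shows "vertex_in s q r \<longleftrightarrow> vertex_at s q \<in> edge_at s r"
proof -
  have "vertex_in s q r \<longleftrightarrow> (\<exists>p. occurs_at s p r \<and> same_vertex s p q)"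
    unfolding vertex_in_def using occurs_atD by blast
  also have "\<dots> \<longleftrightarrow> (\<exists>p. occurs_at s p r \<and> vertex_at s q = vertex_at s p)"
    using same_vertex_iff_vertex_at[OF assms(1) _ assms(2)] occurs_atD by metis
  finally show ?thesis by (auto simp: edge_at_def)
qed

lemma set_edge_list_at: "r \<le> length s \<Longrightarrow> set (edge_list_at s r) = edge_at s r"
  by (auto simp: edge_list_at_def set_names_at edge_at_def vertex_at_def)

lemma normal_names_at:
  assumes "local_ok s" "r \<le> length s"
  shows "\<forall>bs\<in>set (names_at s r). normal_numeral bs"
  using assms by (auto simp: set_names_at dest: occurs_atD intro: normal_numeral_name_at)

lemma map_binary_edge_list_at:
  "local_ok s \<Longrightarrow> r \<le> length s \<Longrightarrow> map binary (edge_list_at s r) = names_at s r"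
  unfolding edge_list_at_def map_map
  using normal_names_at by (auto simp: binary_numeral_value intro!: map_idI)

lemma distinct_edge_list_at_iff:
  assumes "local_ok s" "r \<le> length s"
  shows "distinct (edge_list_at s r) \<longleftrightarrow>
    (\<forall>p<r. \<forall>q<r. occurs_at s p r \<and> occurs_at s q r \<and> same_vertex s p q \<longrightarrow> p = q)"
proof -
  have "inj_on numeral_value (set (names_at s r))"
    by (rule inj_on_subset[OF inj_on_numeral_value]) (use normal_names_at[OF assms] in auto)
  then have d: "distinct (edge_list_at s r) \<longleftrightarrow> inj_on (name_at s) {q. occurs_at s q r}"
    using assms(2) by (simp add: edge_list_at_def distinct_map distinct_names_at_iff)
  have same: "same_vertex s p q \<longleftrightarrow> name_at s p = name_at s q"
    if "occurs_at s p r" "occurs_at s q r" for p q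
  proof (rule same_vertex_iff)
    show "p \<le> length s" "q \<le> length s"
      using that[THEN occurs_atD] sym_at_less less_imp_le by blast+
  qed
  have "inj_on (name_at s) {q. occurs_at s q r} \<longleftrightarrow>
      (\<forall>p. occurs_at s p r \<longrightarrow> (\<forall>q. occurs_at s q r \<longrightarrow> same_vertex s p q \<longrightarrow> p = q))"
    by (simp add: inj_on_def same)
  also have "\<dots> \<longleftrightarrow> (\<forall>p<r. \<forall>q<r. occurs_at s p r \<and> occurs_at s q r \<and> same_vertex s p q \<longrightarrow> p = q)"
    using occurs_atD by blast
  finally show ?thesis unfolding d .
qed

lemma vertices_distinct_iff:
  assumes "local_ok s"
  shows "vertices_distinct s \<longleftrightarrow> (\<forall>r. sym_at s EE r \<longrightarrow> distinct (edge_list_at s r))"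
proof -
  have "vertices_distinct s \<longleftrightarrow>
      (\<forall>r<length s. sym_at s EE r \<longrightarrow> distinct (edge_list_at s r))"
    unfolding vertices_distinct_def
    by (intro all_cong imp_cong refl distinct_edge_list_at_iff[OF assms, symmetric] less_imp_le)
  then show ?thesis using sym_at_less by blast
qed

lemma edge_at_subset_iff:
  assumes "local_ok s"
  shows "edge_at s r \<subseteq> edge_at s r' \<longleftrightarrow> (\<forall>q<r. occurs_at s q r \<longrightarrow> vertex_in s q r')"
proof -
  have "edge_at s r \<subseteq> edge_at s r' \<longleftrightarrow> (\<forall>q. occurs_at s q r \<longrightarrow> vertex_at s q \<in> edge_at s r')"
    by (auto simp: edge_at_def)
  also have "\<dots> \<longleftrightarrow> (\<forall>q<r. occurs_at s q r \<longrightarrow> vertex_in s q r')"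
    using vertex_in_iff[OF assms] occurs_atD by blast
  finally show ?thesis .
qed

text \<open>The two inclusions in the formula express equality of edges as sets, whatever the order
  in which their vertices are listed.\<close>

lemma edges_distinct_iff:
  assumes "local_ok s"
  shows "edges_distinct s \<longleftrightarrow>
    inj_on (edge_at s) {r. left_edge s r} \<and> inj_on (edge_at s) {r. right_edge s r}"
proof -
  have lt: "left_edge s r \<Longrightarrow> r < length s" "right_edge s r \<Longrightarrow> r < length s" for r
    by (auto simp: left_edge_def right_edge_def dest: sym_at_less)
  have "edges_distinct s \<longleftrightarrow> (\<forall>r<length s. \<forall>r'<length s.
      (left_edge s r \<and> left_edge s r' \<or> right_edge s r \<and> right_edge s r') \<and>
      edge_at s r = edge_at s r' \<longrightarrow> r = r')"
    unfolding edges_distinct_def edge_at_subset_iff[OF assms, symmetric] set_eq_subset ..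
  then show ?thesis
    unfolding inj_on_def mem_Collect_eq using lt by blast
qed

lemma covering_iff:
  assumes "local_ok s"
  shows "covering s \<longleftrightarrow> vertices s \<subseteq> \<Union> (left_edges s) \<and> vertices s \<subseteq> \<Union> (right_edges s)"
proof -
  have lt: "left_edge s r \<Longrightarrow> r < length s" "right_edge s r \<Longrightarrow> r < length s" for r
    by (auto simp: left_edge_def right_edge_def dest: sym_at_less)
  have "covering s \<longleftrightarrow> (\<forall>q. sym_at s EV q \<longrightarrow>
      (\<exists>r. left_edge s r \<and> vertex_in s q r) \<and> (\<exists>r. right_edge s r \<and> vertex_in s q r))"
    unfolding covering_def using lt sym_at_less by blast
  also have "\<dots> \<longleftrightarrow> (\<forall>q. sym_at s EV q \<longrightarrow>
      (\<exists>r. left_edge s r \<and> vertex_at s q \<in> edge_at s r) \<and>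
      (\<exists>r. right_edge s r \<and> vertex_at s q \<in> edge_at s r))"
    by (simp add: vertex_in_iff[OF assms])
  finally show ?thesis
    unfolding vertices_def left_edges_def right_edges_def by blast
qed

section \<open>Splitting the word at the two terminators\<close>

definition edge_ends :: "sym list \<Rightarrow> nat list" where
  "edge_ends s = filter (sym_at s EE) [0..<length s]"

text \<open>\<open>L\<close> and \<open>R\<close> hold the end marks of the edges of the two
  hypergraphs; \<open>a\<close> and \<open>b\<close> are the terminators.\<close>

definition edge_ends_split :: "sym list \<Rightarrow> nat list \<Rightarrow> nat \<Rightarrow> nat list \<Rightarrow> nat \<Rightarrow> bool" where
  "edge_ends_split s L a R b \<longleftrightarrow> edge_ends s = L @ a # R @ [b] \<and> Suc b = length s \<and>
     L \<noteq> [] \<and> R \<noteq> [] \<and> names_at s a = [] \<and> names_at s b = [] \<and>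
     (\<forall>r\<in>set L \<union> set R. names_at s r \<noteq> [])"

lemma edge_ends_split_if_two_parts:
  assumes "two_parts s"
  shows "\<exists>L a R b. edge_ends_split s L a R b"
proof -
  obtain a b where ab: "a < length s" "b < length s" "empty_edge_at s a" "empty_edge_at s b" "a < b"
    and last: "\<forall>r<length s. r \<le> b"
    and only: "\<forall>r<length s. empty_edge_at s r \<longrightarrow> r = a \<or> r = b"
    and ne: "\<exists>r<a. sym_at s EE r" "\<exists>r<b. a < r \<and> sym_at s EE r"
    using assms unfolding two_parts_def by blast
  have b: "Suc b = length s"
    using last ab(2) by (metis Suc_lessI lessI not_less)
  have "[0..<length s] = [0..<a] @ a # [Suc a..<b] @ [b]"
  proof -
    have "[0..<length s] = [0..<b] @ [b]" by (simp flip: b)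
    also have "[0..<b] = [0..<a] @ [a..<b]"
      using upt_add_eq_append[of 0 a "b - a"] \<open>a < b\<close> by simp
    also have "[a..<b] = a # [Suc a..<b]" using \<open>a < b\<close> by (rule upt_conv_Cons)
    finally show ?thesis by simp
  qed
  moreover have "sym_at s EE a" "sym_at s EE b"
    using ab by (auto simp: empty_edge_at_def)
  ultimately have "edge_ends s = filter (sym_at s EE) [0..<a] @ a # filter (sym_at s EE) [Suc a..<b] @ [b]"
    by (simp add: edge_ends_def)
  moreover have "filter (sym_at s EE) [0..<a] \<noteq> []" "filter (sym_at s EE) [Suc a..<b] \<noteq> []"
    using ne by (auto simp: filter_empty_conv Suc_le_eq)
  moreover have "names_at s r \<noteq> []" if "sym_at s EE r" "r \<noteq> a" "r \<noteq> b" for r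
    using that only sym_at_less[OF that(1)] by (auto simp: empty_edge_at_iff)
  moreover have "names_at s a = []" "names_at s b = []"
    using ab by (auto simp: empty_edge_at_iff)
  moreover have "\<forall>r\<in>set (filter (sym_at s EE) [0..<a]) \<union> set (filter (sym_at s EE) [Suc a..<b]).
      sym_at s EE r \<and> r \<noteq> a \<and> r \<noteq> b"
    using \<open>a < b\<close> by auto
  ultimately have "edge_ends_split s (filter (sym_at s EE) [0..<a]) a (filter (sym_at s EE) [Suc a..<b]) b"
    unfolding edge_ends_split_def using b by blast
  then show ?thesis by blast
qed

lemma edge_ends_splitD:
  assumes "edge_ends_split s L a R b"
  shows "two_parts s"
    and "left_edge s r \<longleftrightarrow> r \<in> set L" "right_edge s r \<longleftrightarrow> r \<in> set R"
    and "distinct L" "distinct R"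
proof -
  have e: "edge_ends s = L @ a # R @ [b]" and b: "Suc b = length s" and ne: "L \<noteq> []" "R \<noteq> []"
    and n: "names_at s a = []" "names_at s b = []" "\<And>r. r \<in> set L \<union> set R \<Longrightarrow> names_at s r \<noteq> []"
    using assms by (auto simp: edge_ends_split_def)
  \<comment> \<open>As the end marks are listed in increasing order, places in the list translate
    into comparisons with \<open>a\<close> and \<open>b\<close>.\<close>
  have "sorted_wrt (<) (edge_ends s)"
    unfolding edge_ends_def by (intro sorted_wrt_filter sorted_wrt_upt)
  then have srt: "\<And>r. r \<in> set L \<Longrightarrow> r < a" "\<And>r. r \<in> set R \<Longrightarrow> a < r \<and> r < b" "a < b"
    and d: "sorted_wrt (<) L" "sorted_wrt (<) R"
    by (auto simp: e sorted_wrt_append)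
  have "set (edge_ends s) = {r. sym_at s EE r}"
    by (auto simp: edge_ends_def dest: sym_at_less)
  then have EE: "sym_at s EE r \<longleftrightarrow> r \<in> set L \<or> r = a \<or> r \<in> set R \<or> r = b" for r
    unfolding e by auto
  have empty: "empty_edge_at s r \<longleftrightarrow> r = a \<or> r = b" for r
    using n EE by (auto simp: empty_edge_at_iff)
  have "r \<noteq> a \<and> r \<noteq> b \<and> \<not> a < r \<and> \<not> b < r" if "r \<in> set L" for r
    using srt(1)[OF that] srt(3) by linarith
  moreover have "r \<noteq> a \<and> r \<noteq> b \<and> a < r" if "r \<in> set R" for r
    using srt(2)[OF that] by linarith
  ultimately show "left_edge s r \<longleftrightarrow> r \<in> set L" "right_edge s r \<longleftrightarrow> r \<in> set R"
    unfolding left_edge_def right_edge_def empty EE by blast+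
  show "distinct L" "distinct R"
    using d by (simp_all add: strict_sorted_iff)
  obtain l r where lr: "l \<in> set L" "r \<in> set R"
    using ne by (meson last_in_set)
  have "l < a" "sym_at s EE l" "a < r" "r < b" "sym_at s EE r" "a < length s" "b < length s"
    "\<forall>r<length s. r \<le> b"
    using lr srt EE b by auto
  then show "two_parts s"
    unfolding two_parts_def empty using srt(3) by blast
qed

lemma code_if_edge_ends_split:
  assumes "local_ok s" "edge_ends_split s L a R b"
  shows "code s = enc_hypergraph (map (edge_list_at s) L) @ enc_hypergraph (map (edge_list_at s) R)"
proof -
  have e: "edge_ends s = L @ a # R @ [b]" and b: "Suc b = length s"
    and n: "names_at s a = []" "names_at s b = []"
    using assms(2) by (auto simp: edge_ends_split_def)
  have mem: "r \<in> set (edge_ends s) \<Longrightarrow> r < length s \<and> s ! r = EE" for r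
    by (auto simp: edge_ends_def sym_at_def)
  then have "s ! b = EE" by (simp add: e)
  \<comment> \<open>The word ends with \<open>EE\<close>, so there is no open edge and no pending
    digit, and \<open>unparse\<close> recovers all of \<open>s\<close> from its closed
    edges.\<close>
  then have "names_at s (length s) = []" "name_at s (length s) = []"
    using b by (simp_all add: names_at_Suc name_at_Suc flip: b)
  then have "open_edge (rev s) = []" "trailing_digits (rev s) = []"
    by (simp_all add: names_at_def name_at_def)
  moreover have "closed_edges (rev s) = map (names_at s) (edge_ends s)"
    using closed_edges_eq[of "length s" s] by (simp add: edge_ends_def)
  ultimately have s: "s = concat (map edge_syms (map (names_at s) (edge_ends s)))"
    using unparse[of s] assms(1) by (simp add: local_ok_iff)
  have "map (names_at s) (edge_ends s) = map (map binary) (map (edge_list_at s) (edge_ends s))"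
    using mem map_binary_edge_list_at[OF assms(1)] by (auto simp: less_imp_le)
  with s have "code s = code (concat (map edge_syms (map (map binary) (map (edge_list_at s) (edge_ends s)))))"
    by simp
  also have "\<dots> = concat (map enc_edge (map (edge_list_at s) (edge_ends s)))"
    by (rule code_unparse)
  finally show ?thesis
    by (simp add: e n edge_list_at_def enc_hypergraph_def)
qed

lemma well_formed_iff_adj_lists:
  assumes "local_ok s" "edge_ends_split s L a R b"
  shows "well_formed s \<longleftrightarrow> adj_lists (left_edges s) (map (edge_list_at s) L) \<and>
    adj_lists (right_edges s) (map (edge_list_at s) R) \<and>
    vertices s \<subseteq> \<Union> (left_edges s) \<and> vertices s \<subseteq> \<Union> (right_edges s)"
proof -
  note D = edge_ends_splitD[OF assms(2)]
  have ends: "set (edge_ends s) = {r. sym_at s EE r}"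
    by (auto simp: edge_ends_def dest: sym_at_less)
  have LR: "set L \<union> set R \<union> {a, b} = {r. sym_at s EE r}" "names_at s a = []" "names_at s b = []"
    using assms(2) ends by (auto simp: edge_ends_split_def)
  have set: "set (edge_list_at s r) = edge_at s r" if "r \<in> set L \<union> set R" for r
  proof -
    have "sym_at s EE r" using that LR by blast
    then show ?thesis by (intro set_edge_list_at less_imp_le sym_at_less)
  qed
  have m: "map set (map (edge_list_at s) L) = map (edge_at s) L"
    "map set (map (edge_list_at s) R) = map (edge_at s) R"
    using set by (auto intro!: map_cong)
  have sets: "{r. left_edge s r} = set L" "{r. right_edge s r} = set R"
    using D(2,3) by auto
  have "distinct (map (edge_at s) L) \<longleftrightarrow> inj_on (edge_at s) {r. left_edge s r}"
    "distinct (map (edge_at s) R) \<longleftrightarrow> inj_on (edge_at s) {r. right_edge s r}"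
    using D(4,5) by (simp_all add: distinct_map sets)
  moreover have "vertices_distinct s \<longleftrightarrow> (\<forall>r\<in>set L \<union> set R. distinct (edge_list_at s r))"
  proof -
    \<comment> \<open>\<open>vertices_distinct\<close> speaks of all end marks, including the
      terminators, whose lists are empty and hence distinct.\<close>
    have "distinct (edge_list_at s a)" "distinct (edge_list_at s b)"
      using LR by (simp_all add: edge_list_at_def)
    moreover have "vertices_distinct s \<longleftrightarrow> (\<forall>r\<in>set L \<union> set R \<union> {a, b}. distinct (edge_list_at s r))"
      unfolding LR vertices_distinct_iff[OF assms(1)] by simp
    ultimately show ?thesis by auto
  qed
  moreover have "set (map (edge_at s) L) = left_edges s" "set (map (edge_at s) R) = right_edges s"
    by (simp_all add: left_edges_def right_edges_def sets)
  ultimately show ?thesis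
    unfolding well_formed_def adj_lists_def m edges_distinct_iff[OF assms(1)] covering_iff[OF assms(1)]
    using assms(1) D(1) by auto
qed

lemma hypergraph_vertices:
  assumes "well_formed s"
  shows "hypergraph (vertices s) (left_edges s)" "hypergraph (vertices s) (right_edges s)"
proof -
  have ok: "local_ok s" and cov: "covering s" using assms by (auto simp: well_formed_def)
  obtain L a R b where sp: "edge_ends_split s L a R b"
    using assms edge_ends_split_if_two_parts unfolding well_formed_def by blast
  note D = edge_ends_splitD[OF sp]
  have "finite {q. sym_at s EV q}"
    by (rule finite_subset[of _ "{..<length s}"]) (auto dest: sym_at_less)
  then have "finite (vertices s)" by (simp add: vertices_def)
  moreover have "edge_at s r \<subseteq> vertices s" for r
    by (auto simp: edge_at_def vertices_def dest: occurs_atD)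
  moreover have "{} \<notin> left_edges s" "{} \<notin> right_edges s"
  proof -
    have "edge_at s r \<noteq> {}" if "left_edge s r \<or> right_edge s r" for r
      using that by (auto simp: left_edge_def right_edge_def empty_edge_at_def edge_at_def)
    then show "{} \<notin> left_edges s" "{} \<notin> right_edges s"
      by (metis imageE left_edges_def mem_Collect_eq, metis imageE right_edges_def mem_Collect_eq)
  qed
  moreover have "\<exists>r. left_edge s r" "\<exists>r. right_edge s r"
    using sp D(2,3) by (auto simp: edge_ends_split_def neq_Nil_conv)
  ultimately show "hypergraph (vertices s) (left_edges s)" "hypergraph (vertices s) (right_edges s)"
    using cov unfolding covering_iff[OF ok] hypergraph_def left_edges_def right_edges_def by auto
qed

text \<open>The smaller of two different end marks would lie between \<open>q\<close> and the larger
  one.\<close>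

lemma occurs_in_unique_edge:
  assumes "occurs_at s q r" "occurs_at s q r'" "sym_at s EE r" "sym_at s EE r'"
  shows "r = r'"
  using assms unfolding occurs_at_def by (meson less_imp_le linorder_neqE_nat)

text \<open>The edge of an occurrence ends at the first end-of-edge mark after it. This is no
  terminator, because the edges there are empty.\<close>

lemma ex_occurs_at:
  assumes "edge_ends_split s L a R b" "sym_at s EV q"
  shows "\<exists>r\<in>set L \<union> set R. occurs_at s q r"
proof -
  have e: "edge_ends s = L @ a # R @ [b]" and b: "Suc b = length s"
    and n: "names_at s a = []" "names_at s b = []"
    using assms(1) by (auto simp: edge_ends_split_def)
  have ends: "set (edge_ends s) = {r. sym_at s EE r}"
    by (auto simp: edge_ends_def dest: sym_at_less)
  then have "sym_at s EE b" unfolding e by auto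
  moreover from this have "q \<noteq> b" using assms(2) by (auto simp: sym_at_def)
  ultimately have "q < b \<and> sym_at s EE b"
    using assms(2) b by (auto simp: sym_at_def)
  then obtain r where r: "q < r" "sym_at s EE r" and min: "\<And>t. t < r \<Longrightarrow> \<not> (q < t \<and> sym_at s EE t)"
    using exists_least_iff[of "\<lambda>r. q < r \<and> sym_at s EE r"] by blast
  have "\<not> sym_at s EE q" using assms(2) by (auto simp: sym_at_def)
  then have o: "occurs_at s q r"
    unfolding occurs_at_def using r min assms(2) by (metis le_neq_implies_less)
  moreover have "r \<noteq> a \<and> r \<noteq> b"
    using o n set_names_at[of r s] sym_at_less[OF r(2)] by auto
  moreover have "r \<in> set (edge_ends s)" using r(2) ends by simp
  ultimately show ?thesis unfolding e by auto
qed

text \<open>The symbol word is written down from the two adjacency lists;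
  \<open>closed_edges_unparse\<close> reads the same lists back, and their shape determines the
  split at the terminators.\<close>

lemma parse_represented:
  assumes G: "hypergraph V G" and H: "hypergraph V H" and "represents x G H"
  shows "\<exists>s. x = code s \<and> well_formed s \<and> G = left_edges s \<and> H = right_edges s"
proof -
  obtain gs hs where gs: "adj_lists G gs" and hs: "adj_lists H hs"
    and x: "x = enc_hypergraph gs @ enc_hypergraph hs"
    using assms(3) unfolding represents_def by blast
  \<comment> \<open>The two added empty lists become the terminators.\<close>
  define es where "es = gs @ [] # hs @ [[]]"
  define s where "s = concat (map edge_syms (map (map binary) es))"
  have cs: "code s = x"
    unfolding s_def code_unparse by (simp add: x es_def enc_hypergraph_def)
  have ok: "local_ok s"
    unfolding local_ok_iff s_def
    by (rule successively_unparse) (auto simp: normal_numeral_binary)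
  have "map (names_at s) (edge_ends s) = map (map binary) es"
    using closed_edges_eq[of "length s" s] closed_edges_unparse[of "map (map binary) es"]
    by (simp add: edge_ends_def s_def)
  then have "map (names_at s) (edge_ends s) =
      map (map binary) gs @ [] # map (map binary) hs @ [[]]"
    by (simp add: es_def)
  then obtain L t where "edge_ends s = L @ t" and L: "map (names_at s) L = map (map binary) gs"
    and t: "map (names_at s) t = [] # map (map binary) hs @ [[]]"
    unfolding map_eq_append_conv by metis
  moreover obtain a u where "t = a # u" and a: "names_at s a = []"
    and u: "map (names_at s) u = map (map binary) hs @ [[]]"
    using t by auto
  moreover obtain R v where "u = R @ v" and R: "map (names_at s) R = map (map binary) hs"
    and v: "map (names_at s) v = [[]]"
    using u unfolding map_eq_append_conv by metis
  moreover obtain b where "v = [b]" and b: "names_at s b = []"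
    using v by auto
  ultimately have e: "edge_ends s = L @ a # R @ [b]" and n: "names_at s a = []" "names_at s b = []"
    by simp_all
  have "s \<noteq> []" "last s = EE"
    by (simp_all add: s_def es_def edge_syms_def)
  \<comment> \<open>The last symbol is an end mark, and \<open>b\<close> is the greatest end mark
    because \<open>edge_ends s\<close> is increasing.\<close>
  have last: "Suc b = length s"
  proof -
    have "sorted_wrt (<) (edge_ends s)"
      unfolding edge_ends_def by (intro sorted_wrt_filter sorted_wrt_upt)
    moreover have "length s - 1 \<in> set (edge_ends s)"
      using \<open>s \<noteq> []\<close> \<open>last s = EE\<close> by (simp add: edge_ends_def sym_at_def last_conv_nth)
    moreover have "b < length s"
    proof -
      have "b \<in> set (edge_ends s)" by (simp add: e)
      then show ?thesis by (simp add: edge_ends_def)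
    qed
    ultimately have "length s - 1 \<le> b"
      unfolding e by (auto simp: sorted_wrt_append)
    then show ?thesis using \<open>b < length s\<close> by linarith
  qed
  have L': "map (edge_list_at s) L = gs" and R': "map (edge_list_at s) R = hs"
    using arg_cong[OF L, of "map (map numeral_value)"] arg_cong[OF R, of "map (map numeral_value)"]
    by (simp_all add: edge_list_at_def[abs_def] o_def)
  have ne: "[] \<notin> set gs" "[] \<notin> set hs" "gs \<noteq> []" "hs \<noteq> []"
    using gs hs G H by (force simp: adj_lists_def hypergraph_def)+
  have sp: "edge_ends_split s L a R b"
    unfolding edge_ends_split_def using e last n ne L' R' by (auto simp: edge_list_at_def)
  note D = edge_ends_splitD[OF sp]
  have ends: "r < length s" if "r \<in> set L \<union> set R" for r
  proof -
    have "r \<in> set (edge_ends s)" using that by (auto simp: e)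
    then show ?thesis by (simp add: edge_ends_def)
  qed
  have "left_edges s = set (map set gs)" "right_edges s = set (map set hs)"
    unfolding left_edges_def right_edges_def D(2,3) L'[symmetric] R'[symmetric]
    using ends by (force simp: set_edge_list_at)+
  then have GH: "G = left_edges s" "H = right_edges s"
    using gs hs by (simp_all add: adj_lists_def)
  \<comment> \<open>Every vertex is covered, so each of the two hypergraphs determines
    \<open>V\<close>.\<close>
  have V: "V = \<Union> G" "V = \<Union> H" using G H by (auto simp: hypergraph_def)
  have "vertices s \<subseteq> V"
  proof
    fix v assume "v \<in> vertices s"
    then obtain q where q: "sym_at s EV q" "v = vertex_at s q" by (auto simp: vertices_def)
    from ex_occurs_at[OF sp q(1)] obtain r where "r \<in> set L \<union> set R" "v \<in> edge_at s r"
      using q(2) by (auto simp: edge_at_def)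
    then have "v \<in> \<Union> G \<union> \<Union> H"
      unfolding GH left_edges_def right_edges_def D(2,3) by blast
    with V show "v \<in> V" by blast
  qed
  then have "well_formed s"
    using well_formed_iff_adj_lists[OF ok sp] gs hs V by (simp add: L' R' GH)
  with cs GH show ?thesis by blast
qed

lemma represents_code:
  assumes "well_formed s"
  shows "represents (code s) (left_edges s) (right_edges s)"
proof -
  have ok: "local_ok s" using assms by (simp add: well_formed_def)
  obtain L a R b where sp: "edge_ends_split s L a R b"
    using assms edge_ends_split_if_two_parts unfolding well_formed_def by blast
  then show ?thesis
    unfolding represents_def
    using code_if_edge_ends_split[OF ok sp] well_formed_iff_adj_lists[OF ok sp] assms by blast
qed

lemma coDUAL_iff:
  "x \<in> coDUAL \<longleftrightarrow>
    (\<exists>s. x = code s \<and> well_formed s \<and> \<not> dual (vertices s) (left_edges s) (right_edges s))"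
proof
  assume "x \<in> coDUAL"
  then obtain V G H where h: "hypergraph V G" "hypergraph V H" "represents x G H" "\<not> dual V G H"
    by (auto simp: coDUAL_def)
  from parse_represented[OF h(1-3)] obtain s
    where s: "x = code s" "well_formed s" "G = left_edges s" "H = right_edges s" by blast
  \<comment> \<open>The vertex set provided by \<open>coDUAL\<close> coincides with
    \<open>vertices s\<close>, both being the union of the edges.\<close>
  have "V = \<Union> G" "vertices s = \<Union> G"
    using h(1) hypergraph_vertices(1)[OF s(2)] unfolding s(3) hypergraph_def by auto
  with h(4) s show "\<exists>s. x = code s \<and> well_formed s \<and> \<not> dual (vertices s) (left_edges s) (right_edges s)"
    by auto
next
  assume "\<exists>s. x = code s \<and> well_formed s \<and> \<not> dual (vertices s) (left_edges s) (right_edges s)"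
  then show "x \<in> coDUAL"
    unfolding coDUAL_def using hypergraph_vertices represents_code by blast
qed

section \<open>Correctness of the check\<close>

text \<open>In this form every number \<open>p\<close> describes a set, which is empty unless a
  vertex of some edge occurs at \<open>p\<close>.\<close>

definition piece_at :: "sym list \<Rightarrow> nat \<Rightarrow> nat set" where
  "piece_at s p = {v. \<exists>r. right_edge s r \<and> occurs_at s p r \<and> v = vertex_at s p} \<union>
     {v. \<exists>r. left_edge s r \<and> occurs_at s p r \<and> v \<in> edge_at s r - {vertex_at s p}}"

definition excluded_set :: "sym list \<Rightarrow> bool list \<Rightarrow> nat \<Rightarrow> nat set" where
  "excluded_set s y l = \<Union> (piece_at s ` {p. p < length s \<and> guessed y l p})"

lemma edge_less_length:
  "left_edge s r \<Longrightarrow> r < length s" "right_edge s r \<Longrightarrow> r < length s"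
  by (auto simp: left_edge_def right_edge_def dest: sym_at_less)

lemma edge_at_subset_vertices: "edge_at s r \<subseteq> vertices s"
  by (auto simp: edge_at_def vertices_def dest: occurs_atD)

context
  fixes s assumes wf: "well_formed s"
begin

lemma well_formed_local_ok: "local_ok s"
  using wf by (simp add: well_formed_def)

text \<open>The formulas quantify over occurrences; a property that depends only on the vertex can
  be moved to the edge as a set.\<close>

lemma ball_occurs_at_iff:
  assumes "\<And>q. sym_at s EV q \<Longrightarrow> P q \<longleftrightarrow> Q (vertex_at s q)"
  shows "(\<forall>q<r. occurs_at s q r \<longrightarrow> P q) \<longleftrightarrow> (\<forall>v\<in>edge_at s r. Q v)"
proof -
  have "(\<forall>q<r. occurs_at s q r \<longrightarrow> P q) \<longleftrightarrow> (\<forall>q. occurs_at s q r \<longrightarrow> Q (vertex_at s q))"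
    using assms occurs_atD by blast
  then show ?thesis by (auto simp: edge_at_def)
qed

lemma bex_occurs_at_iff:
  assumes "\<And>q. sym_at s EV q \<Longrightarrow> P q \<longleftrightarrow> Q (vertex_at s q)"
  shows "(\<exists>q<r. occurs_at s q r \<and> P q) \<longleftrightarrow> (\<exists>v\<in>edge_at s r. Q v)"
  using ball_occurs_at_iff[of "\<lambda>q. \<not> P q" "\<lambda>v. \<not> Q v" r] assms by blast

lemma excluded_by_iff:
  assumes q: "sym_at s EV q"
  shows "excluded_by s p q \<longleftrightarrow> vertex_at s q \<in> piece_at s p"
proof -
  have same: "same_vertex s p q \<longleftrightarrow> vertex_at s q = vertex_at s p" if "occurs_at s p r" for r
    using same_vertex_iff_vertex_at[OF well_formed_local_ok _ q, of p] occurs_atD[OF that] by auto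
  have "excluded_by s p q \<longleftrightarrow>
     (\<exists>r. right_edge s r \<and> occurs_at s p r \<and> same_vertex s p q) \<or>
     (\<exists>r. left_edge s r \<and> occurs_at s p r \<and> vertex_in s q r \<and> \<not> same_vertex s p q)"
    unfolding excluded_by_def using edge_less_length by blast
  also have "\<dots> \<longleftrightarrow> vertex_at s q \<in> piece_at s p"
    unfolding piece_at_def vertex_in_iff[OF well_formed_local_ok q] using same by auto
  finally show ?thesis .
qed

lemma excluded_iff:
  assumes "sym_at s EV q"
  shows "excluded s y l q \<longleftrightarrow> vertex_at s q \<in> excluded_set s y l"
  unfolding excluded_def excluded_set_def excluded_by_iff[OF assms] by blast

lemma remaining_iff:
  "remaining s y l r \<longleftrightarrow> right_edge s r \<and> edge_at s r \<inter> excluded_set s y l = {}"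
proof -
  have "(\<forall>q<r. occurs_at s q r \<longrightarrow> \<not> excluded s y l q) \<longleftrightarrow> (\<forall>v\<in>edge_at s r. v \<notin> excluded_set s y l)"
    by (rule ball_occurs_at_iff) (simp add: excluded_iff)
  then show ?thesis unfolding remaining_def by blast
qed

text \<open>Counting end marks counts edges, since \<open>edges_distinct\<close> makes
  \<open>edge_at\<close> injective on them.\<close>

lemma card_right_edges:
  "card {r. r < length s \<and> (right_edge s r \<and> P (edge_at s r))} = card {h\<in>right_edges s. P h}"
proof -
  have "inj_on (edge_at s) {r. right_edge s r}"
    using wf edges_distinct_iff[OF well_formed_local_ok] by (simp add: well_formed_def)
  then have inj: "inj_on (edge_at s) {r. r < length s \<and> (right_edge s r \<and> P (edge_at s r))}"
    by (rule inj_on_subset) auto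
  have "edge_at s ` {r. r < length s \<and> (right_edge s r \<and> P (edge_at s r))} =
      {h\<in>right_edges s. P h}"
    by (auto simp: right_edges_def dest: edge_less_length)
  with card_image[OF inj] show ?thesis by simp
qed

abbreviation "frequent_set y l \<equiv> frequent_vertices (vertices s) (right_edges s) (excluded_set s y l)"

lemma frequent_iff:
  assumes q: "sym_at s EV q"
  shows "frequent s y l q \<longleftrightarrow> vertex_at s q \<in> frequent_set y l"
proof -
  have 1: "card {r. r < length s \<and> remaining s y l r} =
      card (missing (right_edges s) (excluded_set s y l))"
    unfolding remaining_iff missing_def by (rule card_right_edges)
  have "card {r. r < length s \<and> (remaining s y l r \<and> vertex_in s q r)} =
      card {h\<in>right_edges s. h \<inter> excluded_set s y l = {} \<and> vertex_at s q \<in> h}"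
    unfolding remaining_iff vertex_in_iff[OF well_formed_local_ok q] conj_assoc by (rule card_right_edges)
  also have "{h\<in>right_edges s. h \<inter> excluded_set s y l = {} \<and> vertex_at s q \<in> h} =
      {h\<in>missing (right_edges s) (excluded_set s y l). vertex_at s q \<in> h}"
    by (auto simp: missing_def)
  finally have 2: "card {r. r < length s \<and> (remaining s y l r \<and> vertex_in s q r)} =
      card {h\<in>missing (right_edges s) (excluded_set s y l). vertex_at s q \<in> h}" .
  have "vertex_at s q \<in> vertices s" using q by (simp add: vertices_def)
  then show ?thesis
    unfolding frequent_def frequent_vertices_def 1 2 excluded_iff[OF q] by simp
qed

lemma frequent_witness_iff:
  "frequent_witness s y l \<longleftrightarrow> new_transversal (vertices s) (left_edges s) (right_edges s) (frequent_set y l)"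
proof -
  have "(\<exists>q<r. occurs_at s q r \<and> frequent s y l q) \<longleftrightarrow> (\<exists>v\<in>edge_at s r. v \<in> frequent_set y l)" for r
    by (rule bex_occurs_at_iff) (rule frequent_iff)
  moreover have "(\<exists>q<r. occurs_at s q r \<and> \<not> frequent s y l q) \<longleftrightarrow> (\<exists>v\<in>edge_at s r. v \<notin> frequent_set y l)" for r
    by (rule bex_occurs_at_iff) (simp add: frequent_iff)
  ultimately have "frequent_witness s y l \<longleftrightarrow>
      (\<forall>r<length s. left_edge s r \<longrightarrow> (\<exists>v\<in>edge_at s r. v \<in> frequent_set y l)) \<and>
      (\<forall>r<length s. right_edge s r \<longrightarrow> (\<exists>v\<in>edge_at s r. v \<notin> frequent_set y l))"
    unfolding frequent_witness_def by simp
  also have "\<dots> \<longleftrightarrow> (\<forall>g\<in>left_edges s. \<exists>v\<in>g. v \<in> frequent_set y l) \<and> (\<forall>h\<in>right_edges s. \<exists>v\<in>h. v \<notin> frequent_set y l)"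
    unfolding left_edges_def right_edges_def using edge_less_length by auto
  also have "\<dots> \<longleftrightarrow> new_transversal (vertices s) (left_edges s) (right_edges s) (frequent_set y l)"
  proof -
    have "frequent_set y l \<subseteq> vertices s" by (auto simp: frequent_vertices_def)
    then show ?thesis
      unfolding new_transversal_def transversal_def by blast
  qed
  finally show ?thesis .
qed

lemma minimal_transversal_at_iff:
  "minimal_transversal_at s r \<longleftrightarrow> edge_at s r \<in> tr (vertices s) (left_edges s)"
proof -
  have "(\<exists>q<g. occurs_at s q g \<and> vertex_in s q r) \<longleftrightarrow> (\<exists>v\<in>edge_at s g. v \<in> edge_at s r)" for g
    by (rule bex_occurs_at_iff) (rule vertex_in_iff[OF well_formed_local_ok])
  moreover have "(\<forall>q<r. occurs_at s q r \<longrightarrow> (\<exists>g<length s. left_edge s g \<and>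
       (\<forall>p<g. occurs_at s p g \<and> vertex_in s p r \<longrightarrow> same_vertex s p q))) \<longleftrightarrow>
     (\<forall>v\<in>edge_at s r. \<exists>g<length s. left_edge s g \<and> (\<forall>u\<in>edge_at s g. u \<in> edge_at s r \<longrightarrow> u = v))"
  proof (rule ball_occurs_at_iff)
    fix q assume q: "sym_at s EV q"
    have "(\<forall>p<g. occurs_at s p g \<longrightarrow> (vertex_in s p r \<longrightarrow> same_vertex s p q)) \<longleftrightarrow>
      (\<forall>u\<in>edge_at s g. u \<in> edge_at s r \<longrightarrow> u = vertex_at s q)" for g
      by (rule ball_occurs_at_iff)
        (simp add: vertex_in_iff[OF well_formed_local_ok] same_vertex_iff_vertex_at[OF well_formed_local_ok _ q])
    then show "(\<exists>g<length s. left_edge s g \<and>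
       (\<forall>p<g. occurs_at s p g \<and> vertex_in s p r \<longrightarrow> same_vertex s p q)) \<longleftrightarrow>
      (\<exists>g<length s. left_edge s g \<and> (\<forall>u\<in>edge_at s g. u \<in> edge_at s r \<longrightarrow> u = vertex_at s q))"
      by (simp add: imp_conjL)
  qed
  ultimately have "minimal_transversal_at s r \<longleftrightarrow>
      (\<forall>g<length s. left_edge s g \<longrightarrow> (\<exists>v\<in>edge_at s g. v \<in> edge_at s r)) \<and>
      (\<forall>v\<in>edge_at s r. \<exists>g<length s. left_edge s g \<and> (\<forall>u\<in>edge_at s g. u \<in> edge_at s r \<longrightarrow> u = v))"
    unfolding minimal_transversal_at_def by simp
  also have "\<dots> \<longleftrightarrow> (\<forall>g\<in>left_edges s. \<exists>v\<in>g. v \<in> edge_at s r) \<and>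
      (\<forall>v\<in>edge_at s r. \<exists>g\<in>left_edges s. \<forall>u\<in>g. u \<in> edge_at s r \<longrightarrow> u = v)"
  proof -
    have "(\<forall>g<length s. left_edge s g \<longrightarrow> P g) \<longleftrightarrow> (\<forall>g. left_edge s g \<longrightarrow> P g)"
      "(\<exists>g<length s. left_edge s g \<and> P g) \<longleftrightarrow> (\<exists>g. left_edge s g \<and> P g)" for P
      using edge_less_length(1) by blast+
    then show ?thesis by (simp add: left_edges_def)
  qed
  also have "\<dots> \<longleftrightarrow> edge_at s r \<in> tr (vertices s) (left_edges s)"
  proof -
    have "(\<exists>v\<in>g. v \<in> E) \<longleftrightarrow> E \<inter> g \<noteq> {}" "(\<forall>u\<in>g. u \<in> E \<longrightarrow> u = v) \<longleftrightarrow> g \<inter> E \<subseteq> {v}"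
      for g E :: "nat set" and v
      by blast+
    then show ?thesis
      unfolding mem_tr_iff transversal_def using edge_at_subset_vertices[of s r] by (simp only: simp_thms)
  qed
  finally show ?thesis .
qed

lemma accepts_iff:
  "accepts (s, y) \<longleftrightarrow> \<not> right_edges s \<subseteq> tr (vertices s) (left_edges s) \<or>
     (\<exists>l<length (pair_word (code s) y).
       new_transversal (vertices s) (left_edges s) (right_edges s) (frequent_set y l))"
proof -
  have "(\<exists>r<length s. right_edge s r \<and> \<not> minimal_transversal_at s r) \<longleftrightarrow>
      (\<exists>r. right_edge s r \<and> edge_at s r \<notin> tr (vertices s) (left_edges s))"
    unfolding minimal_transversal_at_iff using edge_less_length(2) by blast
  also have "\<dots> \<longleftrightarrow> \<not> right_edges s \<subseteq> tr (vertices s) (left_edges s)"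
    unfolding right_edges_def by blast
  finally show ?thesis
    by (simp only: accepts_def frequent_witness_iff fst_conv snd_conv wf simp_thms)
qed

text \<open>The guess is arbitrary here: each disjunct of \<open>accepts_iff\<close> refutes duality
  by itself.\<close>

lemma not_dual_if_accepts:
  assumes "accepts (s, y)"
  shows "\<not> dual (vertices s) (left_edges s) (right_edges s)"
proof -
  have "finite (vertices s)"
    using hypergraph_vertices(1)[OF wf] by (simp add: hypergraph_def)
  with assms show ?thesis
    unfolding accepts_iff using not_dual_if_new_transversal by (auto simp: dual_def)
qed

lemma piece_at_right:
  assumes "right_edge s r" "occurs_at s q r" shows "piece_at s q = {vertex_at s q}"
proof -
  have "\<not> left_edge s r'" if "occurs_at s q r'" for r'
  proof
    assume "left_edge s r'"
    with assms that have "r = r'"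
      by (intro occurs_in_unique_edge) (auto simp: left_edge_def right_edge_def)
    with \<open>left_edge s r'\<close> assms(1) show False by (auto simp: left_edge_def right_edge_def)
  qed
  with assms show ?thesis unfolding piece_at_def by blast
qed

lemma piece_at_left:
  assumes "left_edge s r" "occurs_at s q r" shows "piece_at s q = edge_at s r - {vertex_at s q}"
proof -
  have unique: "r = r'" if "occurs_at s q r'" "left_edge s r' \<or> right_edge s r'" for r'
    using assms that by (intro occurs_in_unique_edge) (auto simp: left_edge_def right_edge_def)
  have "\<not> right_edge s r" using assms(1) by (auto simp: left_edge_def right_edge_def)
  with assms unique show ?thesis unfolding piece_at_def by blast
qed

text \<open>A singleton is described by an occurrence of its vertex in a right edge, which exists by
  \<open>covering\<close>, and \<open>g - {v}\<close> by the occurrence of \<open>v\<close> in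
  \<open>g\<close>. Since an occurrence belongs to one edge only, it describes nothing else.\<close>

lemma ex_piece_at:
  assumes "p \<in> pieces (vertices s) (left_edges s)"
  shows "\<exists>q<length s. piece_at s q = p"
proof -
  consider v where "v \<in> vertices s" "p = {v}"
    | r v where "left_edge s r" "v \<in> edge_at s r" "p = edge_at s r - {v}"
    using assms by (auto simp: pieces_def left_edges_def)
  then show ?thesis
  proof cases
    case (1 v)
    have "covering s" using wf by (simp add: well_formed_def)
    then obtain r where r: "right_edge s r" "v \<in> edge_at s r"
      using 1(1) unfolding covering_iff[OF well_formed_local_ok] right_edges_def by blast
    then obtain q where q: "occurs_at s q r" "v = vertex_at s q" by (auto simp: edge_at_def)
    then show ?thesis
      using 1 piece_at_right[OF r(1) q(1)] occurs_atD[OF q(1)] sym_at_less by blast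
  next
    case (2 r v)
    then obtain q where q: "occurs_at s q r" "v = vertex_at s q" by (auto simp: edge_at_def)
    then show ?thesis
      using 2 piece_at_left[OF 2(1) q(1)] occurs_atD[OF q(1)] sym_at_less by blast
  qed
qed

end

section \<open>Guesses as blocks of bits and their length\<close>

definition blocks :: "nat \<Rightarrow> nat list \<Rightarrow> bool list" where
  "blocks l qs = concat (map (\<lambda>q. map (bit q) [0..<l]) qs)"

lemma blocks_simps [simp]:
  "blocks l [] = []" "blocks l (q # qs) = map (bit q) [0..<l] @ blocks l qs"
  by (simp_all add: blocks_def)

lemma length_blocks [simp]: "length (blocks l qs) = length qs * l"
  by (induction qs) auto

lemma nth_blocks: "i < length qs \<Longrightarrow> j < l \<Longrightarrow> blocks l qs ! (i * l + j) = bit (qs ! i) j"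
proof (induction qs arbitrary: i)
  case (Cons q qs)
  then show ?case
    by (cases i) (simp_all add: nth_append add.assoc)
qed simp

lemma nat_eq_if_bits_eq:
  fixes p q :: nat
  assumes "p < 2 ^ l" "q < 2 ^ l" "\<And>j. j < l \<Longrightarrow> bit p j \<longleftrightarrow> bit q j"
  shows "p = q"
proof -
  have "take_bit l p = take_bit l q"
    by (rule bit_eqI) (use assms(3) in \<open>auto simp: bit_take_bit_iff\<close>)
  with assms(1,2) show ?thesis by (simp add: take_bit_nat_eq_self)
qed

text \<open>Read with the block length used for writing, the blocks are aligned, and a number below
  \<open>2 ^ l\<close> is determined by its first \<open>l\<close> bits.\<close>

lemma guessed_blocks_iff:
  assumes "0 < l" "p < 2 ^ l" "\<forall>q\<in>set qs. q < 2 ^ l"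
  shows "guessed (blocks l qs) l p \<longleftrightarrow> p \<in> set qs"
proof
  assume "guessed (blocks l qs) l p"
  then obtain i where i: "\<And>j. j < l \<Longrightarrow> i * l + j < length qs * l \<and>
      (blocks l qs ! (i * l + j) \<longleftrightarrow> bit p j)"
    unfolding guessed_def length_blocks by blast
  have "i * l < length qs * l" using i[OF assms(1)] by simp
  then have il: "i < length qs" by simp
  have "p = qs ! i"
  proof (rule nat_eq_if_bits_eq[OF assms(2)])
    show "qs ! i < 2 ^ l" using assms(3) il by simp
    show "bit p j \<longleftrightarrow> bit (qs ! i) j" if "j < l" for j
      using i[OF that] nth_blocks[OF il that] by simp
  qed
  with il show "p \<in> set qs" by simp
next
  assume "p \<in> set qs"
  then obtain i where i: "i < length qs" "qs ! i = p" by (auto simp: in_set_conv_nth)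
  have "i * l + j < length qs * l" if "j < l" for j
  proof -
    have "i * l + j < Suc i * l" using that by simp
    also have "\<dots> \<le> length qs * l" using i(1) by (intro mult_le_mono1) simp
    finally show ?thesis .
  qed
  then show "guessed (blocks l qs) l p"
    unfolding guessed_def using assms(1) i nth_blocks[of i qs _ l] by auto
qed

lemma binary_0: "binary 0 = []"
  by (simp add: binary.simps)

lemma length_binary: "n < 2 ^ length (binary n)" "0 < n \<Longrightarrow> 2 ^ length (binary n) \<le> 2 * n"
proof (induction n rule: binary.induct)
  case (1 n)
  {
    case 1
    show ?case
    proof (cases "n = 0")
      case False
      then have "n div 2 < 2 ^ length (binary (n div 2))" using "1.IH"(1) by simp
      with False show ?thesis by (simp add: binary.simps[of n])
    qed simp
  next
    case 2
    show ?case
    proof (cases "n div 2 = 0")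
      case True
      then show ?thesis using 2 by (simp add: binary.simps[of n] binary_0)
    next
      case False
      then have "2 ^ length (binary (n div 2)) \<le> 2 * (n div 2)" using "1.IH"(2) 2 by simp
      then show ?thesis using 2 by (simp add: binary.simps[of n])
    qed
  }
qed

lemma length_binary_le: "length (binary n) \<le> n"
proof (induction n rule: binary.induct)
  case (1 n)
  then show ?case by (cases "n = 0") (auto simp: binary.simps[of n] binary_0)
qed

text \<open>The factor 2 absorbs an additive 1, the logarithm being at least 1 from
  \<open>n = 2\<close> on.\<close>

lemma length_binary_log:
  assumes "2 \<le> n" shows "real (length (binary n)) \<le> 2 * log 2 (real n)"
proof -
  have "real (2 ^ length (binary n)) \<le> real (2 * n)"
    using length_binary(2)[of n] assms by (simp only: of_nat_le_iff)
  then have "2 ^ length (binary n) \<le> 2 * real n" by simp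
  have "real (length (binary n)) = log 2 (2 ^ length (binary n))"
    by (simp add: log_nat_power)
  also have "\<dots> \<le> log 2 (2 * real n)"
    using \<open>2 ^ length (binary n) \<le> 2 * real n\<close> by (intro log_mono) simp_all
  also have "\<dots> = 1 + log 2 (real n)"
    using assms by (simp add: log_mult)
  also have "\<dots> \<le> 2 * log 2 (real n)"
    using assms log_mono[of 2 2 "real n"] by simp
  finally show ?thesis .
qed

text \<open>The binary length \<open>l\<close> of the input size bounds both the number of pieces
  and the width of a position, so at most \<open>l * l\<close> bits are guessed.\<close>

lemma ex_guess:
  assumes wf: "well_formed s" and nd: "\<not> dual (vertices s) (left_edges s) (right_edges s)"
  shows "\<exists>y. real (length y) \<le> 4 * (log 2 (real (length (code s))))\<^sup>2 \<and> accepts (s, y)"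
  using nd
proof (cases rule: not_dual_cases)
  case 1
  \<comment> \<open>The formula itself finds a right edge that is no minimal transversal, so the
    empty guess suffices.\<close>
  then have "accepts (s, [])" using accepts_iff[OF wf] by auto
  then show ?thesis by (intro exI[of _ "[]"]) simp
next
  case (2 T)
  define n where "n = 2 * length s"
  define l where "l = length (binary n)"
  have hyp: "hypergraph (vertices s) (right_edges s)"
    using hypergraph_vertices[OF wf] by blast
  \<comment> \<open>The existence of an edge yields \<open>2 \<le> n\<close>, which the logarithmic
    bound requires.\<close>
  have "\<exists>r. right_edge s r" using hyp by (auto simp: hypergraph_def right_edges_def)
  then have "length s > 0" using edge_less_length(2) by fastforce
  then have n: "2 \<le> n" unfolding n_def by linarith
  then have l: "0 < l" "n < 2 ^ l" "l \<le> n"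
    using length_binary(1)[of n] length_binary_le[of n] by (auto simp: l_def binary.simps[of n])
  have "card (right_edges s) \<le> card {r. right_edge s r}"
    unfolding right_edges_def
    by (rule card_image_le, rule finite_subset[of _ "{..<length s}"]) (auto dest: edge_less_length)
  also have "\<dots> \<le> card {..<length s}"
    by (rule card_mono) (auto dest: edge_less_length)
  finally have "card (right_edges s) < 2 ^ l" using l(2) by (simp add: n_def)
  then have c: "card (missing (right_edges s) {}) < 2 ^ l" by (simp add: missing_def)
  have "finite (vertices s)" "right_edges s \<subseteq> Pow (vertices s)"
    using hyp by (auto simp: hypergraph_def)
  from short_certificate[OF this 2 _ c]
  obtain ps where ps: "length ps \<le> l" "set ps \<subseteq> pieces (vertices s) (left_edges s)"
    "new_transversal (vertices s) (left_edges s) (right_edges s)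
      (frequent_vertices (vertices s) (right_edges s) (\<Union> (set ps)))"
    by auto
  obtain pos where pos: "\<And>p. p \<in> set ps \<Longrightarrow> pos p < length s \<and> piece_at s (pos p) = p"
    using ex_piece_at[OF wf] ps(2) by (metis subsetD)
  define y where "y = blocks l (map pos ps)"
  have small: "q < 2 ^ l" if "q < length s" for q
    using that l(2) by (simp add: n_def)
  have "guessed y l q \<longleftrightarrow> q \<in> pos ` set ps" if "q < length s" for q
    unfolding y_def using guessed_blocks_iff[OF l(1) small[OF that], of "map pos ps"] small pos by auto
  then have "{q. q < length s \<and> guessed y l q} = pos ` set ps"
    using pos by auto
  then have "excluded_set s y l = \<Union> (set ps)"
    unfolding excluded_set_def using pos by (simp add: image_image)
  \<comment> \<open>The formula quantifies the block length over positions, so \<open>l\<close> must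
    be one.\<close>
  moreover have "l < length (pair_word (code s) y)"
    using l(3) by (simp add: n_def)
  ultimately have "accepts (s, y)"
    unfolding accepts_iff[OF wf] using ps(3) by metis
  moreover have "real (length y) \<le> 4 * (log 2 (real (length (code s))))\<^sup>2"
  proof -
    have "length y \<le> l * l" unfolding y_def using ps(1) by simp
    then have "real (length y) \<le> (real l)\<^sup>2"
      by (metis of_nat_le_iff of_nat_mult power2_eq_square)
    also have "\<dots> \<le> (2 * log 2 (real n))\<^sup>2"
      using length_binary_log[OF n] by (intro power_mono) (simp_all add: l_def)
    finally show ?thesis by (simp add: power_mult_distrib n_def)
  qed
  ultimately show ?thesis by blast
qed

section \<open>Unique decoding and the conclusion\<close>

lemma code_inject: "code s = code t \<Longrightarrow> s = t"
proof (rule nth_equalityI)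
  assume eq: "code s = code t"
  show len: "length s = length t" using arg_cong[OF eq, of length] by simp
  show "s ! i = t ! i" if "i < length s" for i
    using nth_code[of i s 0] nth_code[of i s 1] nth_code[of i t 0] nth_code[of i t 1] that len eq
    by (simp add: sym_code_eq_iff)
qed

text \<open>The first \<open>None\<close> separates the input from the guess.\<close>

lemma pair_word_inject: "pair_word x y = pair_word x' y' \<Longrightarrow> x = x' \<and> y = y'"
proof -
  assume eq: "pair_word x y = pair_word x' y'"
  have "takeWhile (\<lambda>c. c \<noteq> None) (pair_word a b) = map Some a" for a b
    unfolding pair_word_def by (subst takeWhile_append2) auto
  then have "map Some x = map Some x'" using eq by metis
  then have "x = x'" by (metis inj_Some inj_mapI injD)
  with eq show ?thesis
    unfolding pair_word_def by (simp add: inj_map_eq_map)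
qed

theorem theorem2:
  "coDUAL \<in> GC (\<lambda>n. (log 2 (real n))\<^sup>2) TC0"
proof -
  let ?R = "{pair_word (code s) y | s y. accepts (s, y)}"
  \<comment> \<open>By unique decoding, a coded pair can belong to \<open>?R\<close> only on account
    of that very pair.\<close>
  have R: "pair_word (code s) y \<in> ?R \<longleftrightarrow> accepts (s, y)" for s y
    using pair_word_inject code_inject by (simp, metis)
  have iff: "x \<in> coDUAL \<longleftrightarrow>
      (\<exists>y. real (length y) \<le> 4 * (log 2 (real (length x)))\<^sup>2 \<and> pair_word x y \<in> ?R)" for x
  proof
    assume "x \<in> coDUAL"
    then obtain s where s: "x = code s" "well_formed s" "\<not> dual (vertices s) (left_edges s) (right_edges s)"
      unfolding coDUAL_iff by blast
    from ex_guess[OF s(2,3)] show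
      "\<exists>y. real (length y) \<le> 4 * (log 2 (real (length x)))\<^sup>2 \<and> pair_word x y \<in> ?R"
      unfolding s(1) R .
  next
    assume "\<exists>y. real (length y) \<le> 4 * (log 2 (real (length x)))\<^sup>2 \<and> pair_word x y \<in> ?R"
    then obtain s y z where "pair_word x z = pair_word (code s) y" and a: "accepts (s, y)"
      by blast
    from pair_word_inject[OF this(1)] have x: "x = code s" ..
    have "well_formed s" using a by (simp add: accepts_def)
    then show "x \<in> coDUAL"
      unfolding coDUAL_iff using x not_dual_if_accepts[OF _ a] by blast
  qed
  show ?thesis
    unfolding GC_def mem_Collect_eq
    by (rule bexI[of _ ?R], rule exI[of _ 4], rule allI, rule iff, rule accepts_TC0)
qed

end
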